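(* Let $H$ be a complex Hilbert space with $\dim H\geq 2$ and let $\phi:E(H)\to E(H)$ be a bijective map which preserves the order and coexistency in both directions, i.e., for all $A,B\in E(H)$, $A\leq B\Longleftrightarrow\phi(A)\leq\phi(B)$, and $A,B$ are coexistent if and only if $\phi(A),\phi(B)$ are coexistent. Then there is an either unitary or antiunitary operator $U$ on $H$ such that \[ \phi(A)=UAU^*\qquad (A\in E(H)). \]
   Context: $E(H)$ denotes the set of all (Hilbert space) effects on $H$, i.e., all positive bounded linear operators $A$ on $H$ with $0\leq A\leq I$, where $I$ is the identity. The order $\leq$ is the usual order among self-adjoint bounded linear operators. Two effects $A,B\in E(H)$ are called coexistent if they are in the range of a positive operator valued measure or, equivalently, if there are effects $E,F,G\in E(H)$ such that $A=E+G$, $B=F+G$, and $E+F+G\in E(H)$. *)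

theory Defs
  imports "HOL-Analysis.Analysis"
begin

text \<open>
  A complex inner product space carries its underlying real inner product space structure:
  real scaling is the restriction of complex scaling, and the real inner product (which
  determines the norm) is the real part of the complex one. Hence positive definiteness of
  \<open>cinner\<close> is inherited from \<^class>\<open>real_inner\<close>. The complex inner product is linear in
  its first argument.
\<close>

class complex_inner = real_inner +
  fixes scaleC :: "complex \<Rightarrow> 'a \<Rightarrow> 'a" (infixr "*\<^sub>C" 75)
    and cinner :: "'a \<Rightarrow> 'a \<Rightarrow> complex"
  assumes scaleC_add_right: "a *\<^sub>C (x + y) = a *\<^sub>C x + a *\<^sub>C y"
    and scaleC_add_left: "(a + b) *\<^sub>C x = a *\<^sub>C x + b *\<^sub>C x"
    and scaleC_scaleC: "a *\<^sub>C b *\<^sub>C x = (a * b) *\<^sub>C x"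
    and scaleR_scaleC: "r *\<^sub>R x = complex_of_real r *\<^sub>C x"
    and cinner_commute: "cinner x y = cnj (cinner y x)"
    and cinner_add_left: "cinner (x + y) z = cinner x z + cinner y z"
    and cinner_scaleC_left: "cinner (a *\<^sub>C x) y = a * cinner x y"
    and inner_eq_Re_cinner: "x \<bullet> y = Re (cinner x y)"

lemma scaleC_one: "1 *\<^sub>C x = (x :: 'a :: complex_inner)"
  using scaleR_scaleC[of 1 x] by simp

lemma cinner_self: "cinner x x = complex_of_real ((norm x)\<^sup>2)"
  for x :: "'a :: complex_inner"
proof -
  have "Im (cinner x x) = 0"
    using arg_cong[OF cinner_commute[of x x], of Im] by simp
  then show ?thesis
    by (simp add: complex_eq_iff power2_norm_eq_inner inner_eq_Re_cinner)
qed

interpretation complex_vs: vector_space "scaleC :: complex \<Rightarrow> 'a \<Rightarrow> 'a :: complex_inner"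
  by unfold_locales
    (simp_all add: scaleC_add_right scaleC_add_left scaleC_scaleC scaleC_one)

class complex_hilbert = complex_inner + complete_space

instance complex_hilbert \<subseteq> banach ..


text \<open>
  Bounded operators on \<open>H\<close> are the elements of the library type of bounded real-linear maps
  that commute with complex scaling.
\<close>

definition complex_linear :: "('a::complex_hilbert \<Rightarrow>\<^sub>L 'a) \<Rightarrow> bool" where
  "complex_linear A \<longleftrightarrow> (\<forall>c x. blinfun_apply A (c *\<^sub>C x) = c *\<^sub>C blinfun_apply A x)"

definition self_adjoint :: "('a::complex_hilbert \<Rightarrow>\<^sub>L 'a) \<Rightarrow> bool" where
  "self_adjoint A \<longleftrightarrow> complex_linear A \<and>
    (\<forall>x y. cinner (blinfun_apply A x) y = cinner x (blinfun_apply A y))"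

text \<open>
  The order is only meant for self-adjoint operators, for which the quadratic forms below
  are real-valued.
\<close>

definition op_le :: "('a::complex_hilbert \<Rightarrow>\<^sub>L 'a) \<Rightarrow> ('a \<Rightarrow>\<^sub>L 'a) \<Rightarrow> bool"
    (infix "\<preceq>" 50) where
  "A \<preceq> B \<longleftrightarrow> (\<forall>x. Re (cinner (blinfun_apply A x) x) \<le> Re (cinner (blinfun_apply B x) x))"

lemma self_adjoint_form_real:
  assumes "self_adjoint A"
  shows "Im (cinner (blinfun_apply A x) x) = 0"
proof -
  have "cinner (blinfun_apply A x) x = cnj (cinner (blinfun_apply A x) x)"
    using assms cinner_commute[of x "blinfun_apply A x"] by (simp add: self_adjoint_def)
  from arg_cong[OF this, of Im] show ?thesis
    by simp
qed

definition effects :: "('a::complex_hilbert \<Rightarrow>\<^sub>L 'a) set" where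
  "effects = {A. self_adjoint A \<and> 0 \<preceq> A \<and> A \<preceq> id_blinfun}"

definition coexistent :: "('a::complex_hilbert \<Rightarrow>\<^sub>L 'a) \<Rightarrow> ('a \<Rightarrow>\<^sub>L 'a) \<Rightarrow> bool" where
  "coexistent A B \<longleftrightarrow>
    (\<exists>E\<in>effects. \<exists>F\<in>effects. \<exists>G\<in>effects. A = E + G \<and> B = F + G \<and> E + F + G \<in> effects)"


definition unitary :: "('a::complex_hilbert \<Rightarrow> 'a) \<Rightarrow> bool" where
  "unitary U \<longleftrightarrow> surj U \<and> (\<forall>x y. U (x + y) = U x + U y) \<and> (\<forall>c x. U (c *\<^sub>C x) = c *\<^sub>C U x) \<and>
    (\<forall>x y. cinner (U x) (U y) = cinner x y)"

definition antiunitary :: "('a::complex_hilbert \<Rightarrow> 'a) \<Rightarrow> bool" where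
  "antiunitary U \<longleftrightarrow> surj U \<and> (\<forall>x y. U (x + y) = U x + U y) \<and>
    (\<forall>c x. U (c *\<^sub>C x) = cnj c *\<^sub>C U x) \<and> (\<forall>x y. cinner (U x) (U y) = cnj (cinner x y))"

text \<open>
  The library's \<^const>\<open>adjoint\<close> is taken with respect to the real inner product. For unitary
  and for antiunitary operators it is the usual adjoint (respectively the adjoint of a
  conjugate-linear operator), and it is the inverse.
\<close>

lemma adjoint_of_surj_isometry:
  fixes U :: "'a::real_inner \<Rightarrow> 'a"
  assumes "surj U" and iso: "\<And>x y. U x \<bullet> U y = x \<bullet> y"
  shows "U (adjoint U y) = y" and "adjoint U (U x) = x"
proof -
  have "U x \<bullet> y = x \<bullet> inv U y" for x y
    using iso[of x "inv U y"] surj_f_inv_f[OF assms(1)] by simp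
  then have "adjoint U = inv U"
    by (intro adjoint_unique allI)
  then show *: "U (adjoint U y) = y" for y
    using surj_f_inv_f[OF assms(1)] by simp
  have "inj U"
  proof (rule injI)
    fix x x' assume "U x = U x'"
    then have "x \<bullet> z = x' \<bullet> z" for z
      using iso[of x z] iso[of x' z] by simp
    then show "x = x'"
      using vector_eq_rdot by blast
  qed
  then show "adjoint U (U x) = x"
    using *[of "U x"] by (rule injD)
qed

lemma unitary_adjoint:
  assumes "unitary U"
  shows "cinner (U x) y = cinner x (adjoint U y)"
    and "U \<circ> adjoint U = id" and "adjoint U \<circ> U = id"
proof -
  have "surj U" and iso: "\<And>x y. cinner (U x) (U y) = cinner x y"
    using assms by (auto simp: unitary_def)
  then have *: "U (adjoint U y) = y" "adjoint U (U y) = y" for y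
    using adjoint_of_surj_isometry[of U] by (simp_all add: inner_eq_Re_cinner)
  show "cinner (U x) y = cinner x (adjoint U y)"
    using iso[of x "adjoint U y"] by (simp add: *)
  show "U \<circ> adjoint U = id" "adjoint U \<circ> U = id"
    by (simp_all add: fun_eq_iff *)
qed

lemma antiunitary_adjoint:
  assumes "antiunitary U"
  shows "cinner (U x) y = cnj (cinner x (adjoint U y))"
    and "U \<circ> adjoint U = id" and "adjoint U \<circ> U = id"
proof -
  have "surj U" and iso: "\<And>x y. cinner (U x) (U y) = cnj (cinner x y)"
    using assms by (auto simp: antiunitary_def)
  then have *: "U (adjoint U y) = y" "adjoint U (U y) = y" for y
    using adjoint_of_surj_isometry[of U] by (simp_all add: inner_eq_Re_cinner)
  show "cinner (U x) y = cnj (cinner x (adjoint U y))"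
    using iso[of x "adjoint U y"] by (simp add: *)
  show "U \<circ> adjoint U = id" "adjoint U \<circ> U = id"
    by (simp_all add: fun_eq_iff *)
qed

end

theory Submission
  imports Defs
begin

text \<open>
  The proof reduces everything to the effects of rank at most one, which are the operators
  \<open>rank_one x\<close> sending \<open>z\<close> to \<open>\<langle>z, x\<rangle>x\<close>, for \<open>x\<close> in the unit ball. The order sees them: they are
  exactly the effects below which the order is total (\<open>rank_one_iff_chain_below\<close>), so \<open>\<phi>\<close>
  permutes them, and as the projections are the maximal ones among them, \<open>\<phi>\<close> induces a map
  \<open>\<sigma>\<close> on unit vectors, well defined up to phases. Moreover an effect is determined by the rank-one
  effects below it (\<open>op_le_iff_rank_one_minorants\<close>). It therefore suffices to find a unitary
  or antiunitary \<open>U\<close> with \<open>\<phi> (rank_one x) = rank_one (U x)\<close>, and for this Wigner's theorem asks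
  that the transition probability \<open>\<bar>\<langle>x, y\<rangle>\<bar>\<^sup>2\<close> of two unit vectors equals that of
  \<open>\<sigma> x\<close> and \<open>\<sigma> y\<close>. This is where coexistence enters, in two ways.

  First, the effects that coexist with every effect are the scalars, so \<open>\<phi>\<close> permutes these; write
  \<open>\<phi> (I / (1 + u)) = I / (1 + F u)\<close> with an increasing bijection \<open>F\<close> of the positive reals.
  Comparing with scalars in the order shows that the same \<open>F\<close> governs every ray:
  \<open>\<phi> (rank_one x / (1 + u)) = rank_one (\<sigma> x) / (1 + F u)\<close> for unit vectors \<open>x\<close>.

  Second, for unit vectors \<open>x\<close>, \<open>y\<close> on different rays, \<open>rank_one x / (1 + u)\<close> and
  \<open>rank_one y / (1 + v)\<close> coexist if and only if \<open>\<bar>\<langle>x, y\<rangle>\<bar>\<^sup>2 \<le> u v\<close>, because the only effect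
  below both of them is \<open>0\<close>, so that coexistence means that their sum is at most \<open>I\<close>. Hence the
  transition probability \<open>c = u v\<close> is mapped to \<open>F u \<cdot> F v\<close>, and this number depends on the
  product only. As \<open>\<phi>\<close> also respects orthogonality and planes, the transition
  probabilities \<open>c\<close> and \<open>1 - c\<close> are sent to numbers that add up to \<open>1\<close>. An elementary
  argument (\<open>eq_id_if_multiplicative_and_reflection\<close>) shows that the identity is the only
  function with these properties.
\<close>

section \<open>Complex inner product spaces\<close>

lemma cinner_add_right: "cinner x (y + z) = cinner x y + cinner x z"
  for x :: "'a::complex_inner"
  by (metis cinner_add_left cinner_commute complex_cnj_add)

lemma cinner_scaleC_right: "cinner x (a *\<^sub>C y) = cnj a * cinner x y"
  for x :: "'a::complex_inner"
  by (metis cinner_scaleC_left cinner_commute complex_cnj_mult)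

lemma cinner_scaleR_left: "cinner (r *\<^sub>R x) y = of_real r * cinner x y"
  for x :: "'a::complex_inner"
  by (simp add: scaleR_scaleC cinner_scaleC_left)

lemma cinner_scaleR_right: "cinner x (r *\<^sub>R y) = of_real r * cinner x y"
  for x :: "'a::complex_inner"
  by (simp add: scaleR_scaleC cinner_scaleC_right)

lemma cinner_zero_left [simp]: "cinner 0 x = 0" for x :: "'a::complex_inner"
  using cinner_add_left[of 0 0 x] by simp

lemma cinner_zero_right [simp]: "cinner x 0 = 0" for x :: "'a::complex_inner"
  using cinner_add_right[of x 0 0] by simp

lemma cinner_minus_left: "cinner (- x) y = - cinner x y" for x :: "'a::complex_inner"
  using cinner_add_left[of x "-x" y] by (simp add: add_eq_0_iff)

lemma cinner_minus_right: "cinner x (- y) = - cinner x y" for x :: "'a::complex_inner"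
  using cinner_add_right[of x y "-y"] by (simp add: add_eq_0_iff)

lemma cinner_diff_left: "cinner (x - y) z = cinner x z - cinner y z" for x :: "'a::complex_inner"
  using cinner_add_left[of x "-y" z] by (simp add: cinner_minus_left)

lemma cinner_diff_right: "cinner x (y - z) = cinner x y - cinner x z" for x :: "'a::complex_inner"
  using cinner_add_right[of x y "-z"] by (simp add: cinner_minus_right)

lemmas cinner_simps =
  cinner_add_left cinner_add_right cinner_diff_left cinner_diff_right
  cinner_minus_left cinner_minus_right
  cinner_scaleC_left cinner_scaleC_right cinner_scaleR_left cinner_scaleR_right

lemma norm_scaleC: "norm (c *\<^sub>C x) = cmod c * norm x" for x :: "'a::complex_inner"
proof -
  have "complex_of_real ((norm (c *\<^sub>C x))\<^sup>2) = of_real ((cmod c * norm x)\<^sup>2)"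
    by (simp only: cinner_self[symmetric] cinner_simps)
      (simp add: cinner_self power_mult_distrib complex_norm_square[of c, simplified] mult_ac)
  then have "(norm (c *\<^sub>C x))\<^sup>2 = (cmod c * norm x)\<^sup>2"
    by (simp only: of_real_eq_iff)
  then show ?thesis
    by (rule power2_eq_imp_eq) auto
qed

lemma cmod_cinner_self: "cmod (cinner x x) = (norm x)\<^sup>2" for x :: "'a::complex_inner"
  by (simp add: cinner_self norm_power)

lemma cmod_cinner_commute: "cmod (cinner x y) = cmod (cinner y x)" for x :: "'a::complex_inner"
  by (metis cinner_commute complex_mod_cnj)

lemma ex_phase: "\<exists>c. cmod c = 1 \<and> c * a = of_real (cmod a)"
proof (cases "a = 0")
  case False
  then show ?thesis
    by (intro exI[of _ "cnj a / of_real (cmod a)"])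
      (simp add: norm_divide mult.commute[of "cnj a"] complex_norm_square[symmetric] power2_eq_square)
qed (auto intro: exI[of _ 1])

lemma cmod_cinner_le: "cmod (cinner x y) \<le> norm x * norm y" for x :: "'a::complex_inner"
proof -
  obtain c where c: "cmod c = 1" "c * cinner x y = of_real (cmod (cinner x y))"
    using ex_phase by blast
  have "cmod (cinner x y) = (c *\<^sub>C x) \<bullet> y"
    by (simp add: inner_eq_Re_cinner cinner_simps c)
  also have "\<dots> \<le> norm x * norm y"
    using norm_cauchy_schwarz[of "c *\<^sub>C x" y] by (simp add: norm_scaleC c)
  finally show ?thesis .
qed

text \<open>
  The equality case of the Cauchy-Schwarz inequality: for the phase \<open>c\<close> that makes \<open>\<langle>cx, y\<rangle>\<close>
  nonnegative, \<open>cx - y\<close> has norm zero.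
\<close>

lemma parallel_if_cmod_cinner:
  fixes x y :: "'a::complex_inner"
  assumes "norm x = norm y" "cmod (cinner x y) = (norm y)\<^sup>2"
  shows "\<exists>c. cmod c = 1 \<and> x = c *\<^sub>C y"
proof -
  obtain c where c: "cmod c = 1" "c * cinner x y = of_real (cmod (cinner x y))"
    using ex_phase by blast
  have "(norm (c *\<^sub>C x - y))\<^sup>2 = (norm (c *\<^sub>C x))\<^sup>2 + (norm y)\<^sup>2 - 2 * ((c *\<^sub>C x) \<bullet> y)"
    by (simp add: power2_norm_eq_inner inner_diff_left inner_diff_right inner_commute)
  also have "\<dots> = 0"
    using assms c by (simp add: norm_scaleC inner_eq_Re_cinner cinner_simps)
  finally have "c *\<^sub>C x = y" by simp
  moreover have "cnj c * c = 1"
    using c(1) by (metis mult.commute complex_norm_square of_real_1 power_one)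
  ultimately have "x = cnj c *\<^sub>C y"
    using scaleC_scaleC[of "cnj c" c x] by (auto simp: scaleC_one)
  then show ?thesis
    using c(1) by (intro exI[of _ "cnj c"]) simp
qed

lemma eq_if_cinner:
  fixes x y :: "'a::complex_inner"
  assumes "norm x = norm y" "Re (cinner x y) = (norm y)\<^sup>2"
  shows "x = y"
proof -
  have "(norm (x - y))\<^sup>2 = (norm x)\<^sup>2 + (norm y)\<^sup>2 - 2 * (x \<bullet> y)"
    by (simp add: power2_norm_eq_inner inner_diff_left inner_diff_right inner_commute)
  also have "\<dots> = 0"
    using assms by (simp add: inner_eq_Re_cinner)
  finally show ?thesis by simp
qed

lemma norm_add_orthogonal:
  fixes x y :: "'a::complex_inner"
  assumes "cinner x y = 0"
  shows "(norm (x + y))\<^sup>2 = (norm x)\<^sup>2 + (norm y)\<^sup>2"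
  using assms by (simp add: power2_norm_eq_inner inner_add_left inner_add_right inner_commute[of y x])
   (simp add: inner_eq_Re_cinner)

lemma ex_orthonormal_pair:
  fixes S :: "'a::complex_hilbert set"
  assumes "complex_vs.independent S" "card S = 2"
  shows "\<exists>e f :: 'a. norm e = 1 \<and> norm f = 1 \<and> cinner e f = 0"
proof -
  obtain x y where xy: "S = {x, y}" "x \<noteq> y"
    using assms(2) by (auto simp: card_2_iff)
  have x: "x \<noteq> 0"
    using assms(1) complex_vs.dependent_zero[of S] xy by auto
  define p where "p = y - (cinner y x / of_real ((norm x)\<^sup>2)) *\<^sub>C x"
  have "cinner p x = 0"
    using x by (simp add: p_def cinner_simps cinner_self del: of_real_power)
  then have px: "cinner x p = 0" using cinner_commute[of x p] by simp
  have "p \<noteq> 0"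
  proof
    assume "p = 0"
    then have "y = (cinner y x / of_real ((norm x)\<^sup>2)) *\<^sub>C x" by (simp add: p_def)
    moreover have "x \<in> complex_vs.span (S - {y})"
      using xy by (intro complex_vs.span_base) auto
    ultimately have "y \<in> complex_vs.span (S - {y})"
      using complex_vs.span_scale by metis
    then show False
      using assms(1) xy by (auto simp: complex_vs.dependent_def)
  qed
  then show ?thesis
    using x px by (intro exI[of _ "x /\<^sub>R norm x"] exI[of _ "p /\<^sub>R norm p"]) (simp add: cinner_simps)
qed

section \<open>Wigner's theorem\<close>

text \<open>
  If \<open>x\<close> lies only in \<open>Q\<close> and \<open>y\<close> only in \<open>P\<close>, then \<open>x + y\<close> lies in neither. The lemma will
  turn a sign that could a priori depend on the vector into a global one.
\<close>

lemma additive_subgroup_cover: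
  fixes K P Q :: "'a::ab_group_add set"
  assumes K: "\<And>x y. x \<in> K \<Longrightarrow> y \<in> K \<Longrightarrow> x + y \<in> K"
    and P: "\<And>x y. x \<in> P \<Longrightarrow> y \<in> P \<Longrightarrow> x - y \<in> P"
    and Q: "\<And>x y. x \<in> Q \<Longrightarrow> y \<in> Q \<Longrightarrow> x - y \<in> Q"
    and cover: "K \<subseteq> P \<union> Q" and sub: "P \<subseteq> K" "Q \<subseteq> K"
  shows "K \<subseteq> P \<or> K \<subseteq> Q"
proof (rule ccontr)
  assume "\<not> ?thesis"
  then obtain x y where x: "x \<in> K" "x \<notin> P" "x \<in> Q" and y: "y \<in> K" "y \<notin> Q" "y \<in> P"
    using cover by blast
  have "x + y \<in> P \<or> x + y \<in> Q"
    using cover K x y by blast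
  then show False
    using P[of "x + y" y] Q[of "x + y" x] x y by auto
qed

text \<open>
  The rays that are not orthogonal to a fixed unit vector \<open>e\<close> have exactly one representative
  \<open>e + z\<close> with \<open>z\<close> orthogonal to \<open>e\<close>. In this affine chart a map of rays that preserves moduli of
  inner products becomes a map \<open>T\<close> between honest vectors, defined by asking that \<open>s e + T z\<close> is
  the representative of the ray of \<open>s (e + z)\<close>. The gain is that
  \<open>\<bar>1 + \<langle>z, w\<rangle>\<bar> = \<bar>1 + \<langle>T z, T w\<rangle>\<bar>\<close>, which remembers the real part of the inner product.
\<close>

locale normalized_ray_map =
  fixes s :: "'a::complex_hilbert \<Rightarrow> 'a" and e :: 'a
  assumes ray: "\<And>x y. cmod (cinner (s x) (s y)) = cmod (cinner x y)"
    and e: "norm e = 1"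
begin

lemma norm_s: "norm (s x) = norm x"
  using ray[of x x] by (simp add: cmod_cinner_self)

definition T :: "'a \<Rightarrow> 'a" where
  "T z = cnj (cinner (s (e + z)) (s e)) *\<^sub>C s (e + z) - s e"

lemma cinner_ee: "cinner e e = 1" "cinner (s e) (s e) = 1"
  by (simp_all add: cinner_self norm_s e)

lemma phase:
  assumes "cinner z e = 0"
  shows "cmod (cinner (s (e + z)) (s e)) = 1"
  by (simp add: ray cinner_simps assms cinner_ee)

lemma e_plus_T: "s e + T z = cnj (cinner (s (e + z)) (s e)) *\<^sub>C s (e + z)"
  by (simp add: T_def)

lemma T_orth:
  assumes "cinner z e = 0"
  shows "cinner (T z) (s e) = 0" "cinner (s e) (T z) = 0"
proof -
  let ?b = "cinner (s (e + z)) (s e)"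
  have "cnj ?b * ?b = 1"
    using phase[OF assms] by (metis mult.commute complex_norm_square of_real_1 power_one)
  then show "cinner (T z) (s e) = 0"
    by (simp add: T_def cinner_simps cinner_ee)
  then show "cinner (s e) (T z) = 0"
    by (metis cinner_commute complex_cnj_zero)
qed

lemma cmod_1_T:
  assumes "cinner z e = 0" "cinner w e = 0"
  shows "cmod (1 + cinner (T z) (T w)) = cmod (1 + cinner z w)"
proof -
  have "cinner (s e + T z) (s e + T w) = 1 + cinner (T z) (T w)"
    using T_orth assms by (simp add: cinner_simps cinner_ee)
  moreover have "cinner (e + z) (e + w) = 1 + cinner z w"
    using assms cinner_commute[of e w] by (simp add: cinner_simps cinner_ee)
  moreover have "cmod (cinner (s e + T z) (s e + T w)) = cmod (cinner (e + z) (e + w))"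
    unfolding e_plus_T cinner_scaleC_left cinner_scaleC_right norm_mult complex_mod_cnj ray[of "e + z" "e + w"]
      phase[OF assms(1)] phase[OF assms(2)] by simp
  ultimately show ?thesis by simp
qed

lemma norm_T:
  assumes "cinner z e = 0"
  shows "norm (T z) = norm z"
proof -
  have "cmod (1 + cinner x x) = 1 + (norm x)\<^sup>2" for x :: 'a
  proof -
    have "1 + cinner x x = of_real (1 + (norm x)\<^sup>2)"
      by (simp add: cinner_self)
    then show ?thesis
      by (simp only: norm_of_real) simp
  qed
  then have "(norm (T z))\<^sup>2 = (norm z)\<^sup>2"
    using cmod_1_T[OF assms assms] by (metis add_left_cancel)
  then show ?thesis by simp
qed

text \<open>
  The number \<open>p = \<langle>T (tz), T z\<rangle>\<close> satisfies both \<open>\<bar>p\<bar> \<le> r\<close> and \<open>\<bar>1 + p\<bar> = 1 + r\<close> for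
  \<open>r = t \<parallel>z\<parallel>\<^sup>2\<close>. This forces \<open>p = r\<close>, the equality case of the Cauchy-Schwarz inequality.
\<close>

lemma T_nonneg_scale:
  assumes z: "cinner z e = 0" and t: "t \<ge> 0"
  shows "T (t *\<^sub>R z) = t *\<^sub>R T z"
proof -
  have tz: "cinner (t *\<^sub>R z) e = 0" by (simp add: cinner_simps z)
  let ?p = "cinner (T (t *\<^sub>R z)) (T z)" and ?r = "t * (norm z)\<^sup>2"
  have "cmod ?p \<le> ?r"
    using cmod_cinner_le[of "T (t *\<^sub>R z)" "T z"] t
    by (simp add: norm_T[OF tz] norm_T[OF z] power2_eq_square mult_ac)
  moreover have "cmod (1 + ?p) = 1 + ?r"
  proof -
    have "cmod (1 + ?p) = cmod (of_real (1 + ?r))"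
      using cmod_1_T[OF tz z] by (simp add: cinner_simps cinner_self)
    also have "\<dots> = 1 + ?r"
      unfolding norm_of_real using t by simp
    finally show ?thesis .
  qed
  ultimately have *: "(cmod (1 + ?p))\<^sup>2 = (1 + ?r)\<^sup>2" "(cmod ?p)\<^sup>2 \<le> ?r\<^sup>2"
    by (auto intro: power_mono)
  have "(cmod (1 + ?p))\<^sup>2 = 1 + 2 * Re ?p + (cmod ?p)\<^sup>2"
    unfolding cmod_power2 by (simp add: power2_eq_square algebra_simps)
  with * have "Re ?p \<ge> ?r"
    by (simp add: power2_sum)
  moreover have "Re ?p \<le> cmod ?p" by (rule complex_Re_le_cmod)
  ultimately have Re: "Re ?p = ?r"
    using \<open>cmod ?p \<le> ?r\<close> by linarith
  show ?thesis
  proof (rule eq_if_cinner)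
    show "norm (T (t *\<^sub>R z)) = norm (t *\<^sub>R T z)"
      using t by (simp add: norm_T[OF tz] norm_T[OF z])
    show "Re (cinner (T (t *\<^sub>R z)) (t *\<^sub>R T z)) = (norm (t *\<^sub>R T z))\<^sup>2"
      using t Re by (simp add: cinner_simps norm_T[OF z] power_mult_distrib)
        (simp add: power2_eq_square)
  qed
qed

lemma
  assumes z: "cinner z e = 0" and w: "cinner w e = 0"
  shows inner_T: "T z \<bullet> T w = z \<bullet> w"
    and cmod_cinner_T: "cmod (cinner (T z) (T w)) = cmod (cinner z w)"
proof -
  let ?p = "cinner z w" and ?q = "cinner (T z) (T w)"
  have sq: "(cmod (1 + of_real t * a))\<^sup>2 = 1 + 2 * t * Re a + t\<^sup>2 * (cmod a)\<^sup>2" for t a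
    unfolding cmod_power2 by (simp add: power2_eq_square algebra_simps)
  \<comment> \<open>scaling \<open>z\<close> separates the linear part \<open>Re ?p\<close> from the quadratic part \<open>\<bar>?p\<bar>\<^sup>2\<close>\<close>
  have eq: "2 * t * Re ?q + t\<^sup>2 * (cmod ?q)\<^sup>2 = 2 * t * Re ?p + t\<^sup>2 * (cmod ?p)\<^sup>2"
    if "t \<ge> 0" for t
  proof -
    have tz: "cinner (t *\<^sub>R z) e = 0" by (simp add: cinner_simps z)
    have "cmod (1 + of_real t * ?q) = cmod (1 + of_real t * ?p)"
      using cmod_1_T[OF tz w] by (simp add: T_nonneg_scale[OF z that] cinner_simps)
    then show ?thesis
      using sq[of t ?q] sq[of t ?p] by simp
  qed
  have 1: "2 * Re ?q + (cmod ?q)\<^sup>2 = 2 * Re ?p + (cmod ?p)\<^sup>2"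
    and 2: "4 * Re ?q + 4 * (cmod ?q)\<^sup>2 = 4 * Re ?p + 4 * (cmod ?p)\<^sup>2"
    using eq[of 1] eq[of 2] by simp_all
  from 1 2 have "Re ?q = Re ?p" "(cmod ?q)\<^sup>2 = (cmod ?p)\<^sup>2"
    by linarith+
  then show "T z \<bullet> T w = z \<bullet> w" "cmod ?q = cmod ?p"
    by (simp_all add: inner_eq_Re_cinner)
qed

text \<open>
  A map that preserves real inner products is additive, as the squared norm of the defect
  expands into inner products.
\<close>

lemma T_add:
  assumes z: "cinner z e = 0" and w: "cinner w e = 0"
  shows "T (z + w) = T z + T w"
proof -
  have zw: "cinner (z + w) e = 0" by (simp add: cinner_simps z w)
  have "(norm (T (z + w) - (T z + T w)))\<^sup>2 = 0"
    unfolding power2_norm_eq_inner inner_add_left inner_add_right inner_diff_left inner_diff_right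
      inner_T[OF z z] inner_T[OF z w] inner_T[OF w z] inner_T[OF w w]
      inner_T[OF zw z] inner_T[OF zw w] inner_T[OF z zw] inner_T[OF w zw] inner_T[OF zw zw]
    by simp
  then show ?thesis by simp
qed

lemma T_scaleR:
  assumes z: "cinner z e = 0"
  shows "T (r *\<^sub>R z) = r *\<^sub>R T z"
proof -
  have rz: "cinner (r *\<^sub>R z) e = 0" by (simp add: cinner_simps z)
  have "(norm (T (r *\<^sub>R z) - r *\<^sub>R T z))\<^sup>2 = 0"
    unfolding power2_norm_eq_inner inner_diff_left inner_diff_right
      inner_scaleR_left inner_scaleR_right
      inner_T[OF z z] inner_T[OF rz z] inner_T[OF z rz] inner_T[OF rz rz]
    by simp
  then show ?thesis by simp
qed

lemma T_ii:
  assumes z: "cinner z e = 0"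
  shows "T (\<i> *\<^sub>C z) = \<i> *\<^sub>C T z \<or> T (\<i> *\<^sub>C z) = - \<i> *\<^sub>C T z"
proof -
  have iz: "cinner (\<i> *\<^sub>C z) e = 0" by (simp add: cinner_simps z)
  \<comment> \<open>the real part of \<open>\<langle>iz, z\<rangle>\<close> vanishes, so \<open>?p\<close> is one of the numbers \<open>\<plusminus>i \<parallel>z\<parallel>\<^sup>2\<close>\<close>
  let ?p = "cinner (T (\<i> *\<^sub>C z)) (T z)"
  have Re: "Re ?p = 0"
    using inner_T[OF iz z] by (simp add: inner_eq_Re_cinner cinner_simps cinner_self del: of_real_power)
  have "cmod ?p = (norm z)\<^sup>2"
    using cmod_cinner_T[OF iz z] by (simp add: cinner_simps norm_mult cmod_cinner_self)
  with Re have "\<bar>Im ?p\<bar> = (norm z)\<^sup>2"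
    by (simp add: cmod_def)
  then consider "Im ?p = (norm z)\<^sup>2" | "Im ?p = - (norm z)\<^sup>2"
    by linarith
  then show ?thesis
  proof cases
    case 1
    have "T (\<i> *\<^sub>C z) = \<i> *\<^sub>C T z"
      by (rule eq_if_cinner) (simp_all add: norm_T[OF iz] norm_T[OF z] norm_scaleC cinner_simps 1)
    then show ?thesis ..
  next
    case 2
    have "T (\<i> *\<^sub>C z) = - \<i> *\<^sub>C T z"
      by (rule eq_if_cinner) (simp_all add: norm_T[OF iz] norm_T[OF z] norm_scaleC cinner_simps 2)
    then show ?thesis ..
  qed
qed

text \<open>
  The vectors on which \<open>T\<close> commutes with the imaginary unit, and those on which it anticommutes,
  form two additive subgroups that cover the orthogonal complement of \<open>e\<close>. So one of them is all
  of it. The two cases are recorded by \<open>\<kappa>\<close>, the identity or complex conjugation.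
\<close>

lemma ex_conjugation:
  obtains \<kappa> where "\<kappa> = id \<or> \<kappa> = cnj"
    and "\<And>z. cinner z e = 0 \<Longrightarrow> T (\<i> *\<^sub>C z) = \<kappa> \<i> *\<^sub>C T z"
proof -
  let ?K = "{z. cinner z e = 0}"
  let ?P = "\<lambda>c. {z \<in> ?K. T (\<i> *\<^sub>C z) = c *\<^sub>C T z}"
  have T_diff: "T (z - w) = T z - T w" if "z \<in> ?K" "w \<in> ?K" for z w
    using that T_add[of "z - w" w] by (simp add: cinner_simps)
  have diff: "x - y \<in> ?P c" if "x \<in> ?P c" "y \<in> ?P c" for x y c
    using that T_diff[of "\<i> *\<^sub>C x" "\<i> *\<^sub>C y"] T_diff[of x y]
    by (auto simp: cinner_simps complex_vs.scale_right_diff_distrib)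
  have "?K \<subseteq> ?P \<i> \<or> ?K \<subseteq> ?P (- \<i>)"
  proof (rule additive_subgroup_cover)
    show "?K \<subseteq> ?P \<i> \<union> ?P (- \<i>)"
      using T_ii by blast
    show "x - y \<in> ?P \<i>" if "x \<in> ?P \<i>" "y \<in> ?P \<i>" for x y
      using that by (rule diff)
    show "x - y \<in> ?P (- \<i>)" if "x \<in> ?P (- \<i>)" "y \<in> ?P (- \<i>)" for x y
      using that by (rule diff)
  qed (auto simp: cinner_simps)
  then show thesis
  proof
    assume "?K \<subseteq> ?P \<i>"
    then show thesis by (intro that[of id]) auto
  next
    assume "?K \<subseteq> ?P (- \<i>)"
    then show thesis by (intro that[of cnj]) auto
  qed
qed

text \<open>
  The operator \<open>U\<close> sends \<open>e\<close> to \<open>s e\<close> and agrees with \<open>T\<close> on the orthogonal complement of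
  \<open>e\<close>. By construction it implements \<open>s\<close> on the rays in the chart. On the rays
  orthogonal to \<open>e\<close> it does so too, since such a vector \<open>x\<close> is determined up to a phase by its
  norm, its orthogonality to \<open>e\<close> and its overlap with the vector \<open>e + x\<close> of the chart.
\<close>

lemma extension:
  assumes \<kappa>: "\<kappa> = id \<or> \<kappa> = cnj"
    and ii: "\<And>z. cinner z e = 0 \<Longrightarrow> T (\<i> *\<^sub>C z) = \<kappa> \<i> *\<^sub>C T z"
  obtains U where "\<And>x y. U (x + y) = U x + U y" "\<And>c x. U (c *\<^sub>C x) = \<kappa> c *\<^sub>C U x"
    "\<And>x y. cinner (U x) (U y) = \<kappa> (cinner x y)"
    "\<And>x. \<exists>c. cmod c = 1 \<and> s x = c *\<^sub>C U x"
proof -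
  have \<kappa>_simps [simp]: "\<kappa> (a + b) = \<kappa> a + \<kappa> b" "\<kappa> (a * b) = \<kappa> a * \<kappa> b" "\<kappa> (cnj a) = cnj (\<kappa> a)"
    "cmod (\<kappa> a) = cmod a" "Re (\<kappa> a) = Re a" "\<kappa> 0 = 0" "\<kappa> 1 = 1" "\<kappa> (of_real r) = of_real r" for a b r
    using \<kappa> by auto
  have T_scaleC: "T (c *\<^sub>C z) = \<kappa> c *\<^sub>C T z" if z: "cinner z e = 0" for c z
  proof -
    have iz: "cinner (\<i> *\<^sub>C z) e = 0" by (simp add: cinner_simps z)
    have "c *\<^sub>C z = Re c *\<^sub>R z + Im c *\<^sub>R (\<i> *\<^sub>C z)"
      unfolding scaleR_scaleC scaleC_scaleC scaleC_add_left[symmetric]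
      by (simp add: complex_eq mult.commute)
    then have "T (c *\<^sub>C z) = Re c *\<^sub>R T z + Im c *\<^sub>R T (\<i> *\<^sub>C z)"
      using z iz by (simp add: T_add T_scaleR cinner_simps)
    also have "\<dots> = (of_real (Re c) + of_real (Im c) * \<kappa> \<i>) *\<^sub>C T z"
      by (simp add: ii[OF z] scaleR_scaleC scaleC_scaleC scaleC_add_left)
    also have "of_real (Re c) + of_real (Im c) * \<kappa> \<i> = \<kappa> c"
      using \<kappa> by (auto simp: complex_eq_iff)
    finally show ?thesis .
  qed
  have cinner_T: "cinner (T z) (T w) = \<kappa> (cinner z w)"
    if z: "cinner z e = 0" and w: "cinner w e = 0" for z w
  proof -
    have iw: "cinner (\<i> *\<^sub>C w) e = 0" by (simp add: cinner_simps w)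
    have "Re (cinner (T z) (T w)) = Re (cinner z w)"
      "Re (cinner (T z) (T (\<i> *\<^sub>C w))) = Re (cinner z (\<i> *\<^sub>C w))"
      using inner_T[OF z w] inner_T[OF z iw] by (simp_all add: inner_eq_Re_cinner)
    then show ?thesis
      using \<kappa> by (auto simp: ii[OF w] cinner_simps complex_eq_iff)
  qed
  define z where "z x = x - cinner x e *\<^sub>C e" for x
  define U where "U x = \<kappa> (cinner x e) *\<^sub>C s e + T (z x)" for x
  have z: "cinner (z x) e = 0" for x
    by (simp add: z_def cinner_simps cinner_ee)
  have z': "cinner e (z x) = 0" for x
    using cinner_commute[of e "z x"] by (simp add: z)
  have split: "x = cinner x e *\<^sub>C e + z x" for x
    by (simp add: z_def)
  have z_add: "z (x + y) = z x + z y" for x y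
    by (simp add: z_def cinner_simps scaleC_add_left)
  have z_scale: "z (c *\<^sub>C x) = c *\<^sub>C z x" for c x
    by (simp add: z_def cinner_simps scaleC_scaleC complex_vs.scale_right_diff_distrib)
  show thesis
  proof (rule that[of U])
    show "U (x + y) = U x + U y" for x y
      by (simp add: U_def z_add T_add z cinner_simps scaleC_add_left)
    show scale: "U (c *\<^sub>C x) = \<kappa> c *\<^sub>C U x" for c x
      by (simp add: U_def z_scale T_scaleC z cinner_simps scaleC_scaleC scaleC_add_right)
    show cinner: "cinner (U x) (U y) = \<kappa> (cinner x y)" for x y
    proof -
      have "cinner (U x) (U y) = \<kappa> (cinner x e) * cnj (\<kappa> (cinner y e)) + \<kappa> (cinner (z x) (z y))"
        by (simp add: U_def cinner_simps cinner_T z T_orth cinner_ee)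
      also have "\<dots> = \<kappa> (cinner x e * cnj (cinner y e) + cinner (z x) (z y))"
        by simp
      also have "cinner x e * cnj (cinner y e) + cinner (z x) (z y) = cinner x y"
        by (subst (3) split, subst (4) split) (simp add: cinner_simps cinner_ee z z')
      finally show ?thesis .
    qed
    have norm_U: "norm (U x) = norm x" for x
    proof -
      have "cmod (cinner (U x) (U x)) = cmod (cinner x x)"
        by (simp add: cinner)
      then show ?thesis by (simp add: cmod_cinner_self)
    qed
    have U_e: "s e + T w = U (e + w)" if "cinner w e = 0" for w
      by (simp add: U_def cinner_simps that cinner_ee z_def scaleC_one)
    show "\<exists>c. cmod c = 1 \<and> s x = c *\<^sub>C U x" for x
    proof (rule parallel_if_cmod_cinner)
      show "norm (s x) = norm (U x)"
        by (simp add: norm_s norm_U)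
      have overlap: "cmod (cinner (s y) (U (e + w))) = cmod (cinner y (e + w))"
        if "cinner w e = 0" for y w
        unfolding U_e[OF that, symmetric] e_plus_T cinner_scaleC_right norm_mult complex_mod_cnj
        by (simp only: phase[OF that] mult_1) (rule ray)
      show "cmod (cinner (s x) (U x)) = (norm (U x))\<^sup>2"
      proof (cases "cinner x e = 0")
        case True
        have "cmod (cinner (s x) (s e)) = 0"
          using True by (simp add: ray)
        moreover have "U (e + x) = s e + U x"
          using U_e[OF True] by (simp add: U_def True z_def)
        moreover have "cinner x e = 0" "cmod (cinner x (e + x)) = (norm x)\<^sup>2"
          using True by (simp_all add: cinner_simps cmod_cinner_self)
        ultimately show ?thesis
          using overlap[OF True, of x] by (simp add: cinner_simps norm_U)
      next
        case False
        define w where "w = inverse (cinner x e) *\<^sub>C z x"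
        have w: "cinner w e = 0"
          by (simp add: w_def cinner_simps z)
        have x: "x = cinner x e *\<^sub>C (e + w)"
          by (subst split) (simp add: w_def scaleC_add_right scaleC_scaleC False scaleC_one)
        have "cmod (cinner (s x) (U x)) = cmod (cinner x x)"
          by (subst (2) x, subst (3) x)
            (simp only: scale cinner_simps norm_mult complex_mod_cnj overlap[OF w] \<kappa>_simps)
        then show ?thesis
          by (simp add: cmod_cinner_self norm_U)
      qed
    qed
  qed
qed

end

text \<open>
  The chart at a unit vector provides \<open>U\<close> with all properties except surjectivity, which
  follows from that of \<open>s\<close> because \<open>U\<close> and \<open>s\<close> agree up to phases.
\<close>

theorem wigner:
  fixes s :: "'a::complex_hilbert \<Rightarrow> 'a"
  assumes ray: "\<And>x y. cmod (cinner (s x) (s y)) = cmod (cinner x y)"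
    and onto: "\<And>y. \<exists>c x. y = c *\<^sub>C s x"
  obtains U where "unitary U \<or> antiunitary U" "\<And>x. \<exists>c. cmod c = 1 \<and> s x = c *\<^sub>C U x"
proof (cases "\<exists>e::'a. norm e = 1")
  case False
  have "x = 0" for x :: 'a
  proof (rule ccontr)
    assume "x \<noteq> 0"
    then have "norm (x /\<^sub>R norm x) = 1" by simp
    with False show False by blast
  qed
  then have "x = y" for x y :: 'a by metis
  then show thesis
    by (intro that[of id]) (auto simp: unitary_def intro: exI[of _ 1])
next
  case True
  then obtain e :: 'a where "norm e = 1" ..
  then interpret normalized_ray_map s e
    by unfold_locales (use ray in auto)
  obtain \<kappa> where \<kappa>: "\<kappa> = id \<or> \<kappa> = cnj"
    and ii: "\<And>z. cinner z e = 0 \<Longrightarrow> T (\<i> *\<^sub>C z) = \<kappa> \<i> *\<^sub>C T z"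
    using ex_conjugation by blast
  obtain U where U: "\<And>x y. U (x + y) = U x + U y" "\<And>c x. U (c *\<^sub>C x) = \<kappa> c *\<^sub>C U x"
    "\<And>x y. cinner (U x) (U y) = \<kappa> (cinner x y)"
    and s: "\<And>x. \<exists>c. cmod c = 1 \<and> s x = c *\<^sub>C U x"
    using extension[OF \<kappa> ii] by metis
  have "\<exists>x. y = U x" for y
  proof -
    obtain c x where "y = c *\<^sub>C s x" using onto by blast
    moreover obtain d where "s x = d *\<^sub>C U x" using s by blast
    ultimately have "y = U (\<kappa> (c * d) *\<^sub>C x)"
      using \<kappa> by (auto simp: U(2) scaleC_scaleC)
    then show ?thesis ..
  qed
  then have "surj U"
    by (auto simp: surj_def)
  then have "unitary U \<or> antiunitary U"
    using \<kappa> U by (auto simp: unitary_def antiunitary_def)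
  then show thesis
    using s by (rule that)
qed

section \<open>Rank-one effects and the order\<close>

definition rank_one :: "'a::complex_hilbert \<Rightarrow> 'a \<Rightarrow>\<^sub>L 'a" where
  "rank_one x = Blinfun (\<lambda>z. cinner z x *\<^sub>C x)"

lemma rank_one_apply [simp]: "blinfun_apply (rank_one x) z = cinner z x *\<^sub>C x"
proof -
  have "bounded_linear (\<lambda>z. cinner z x *\<^sub>C x)"
  proof (rule bounded_linear_intro)
    show "norm (cinner z x *\<^sub>C x) \<le> norm z * (norm x * norm x)" for z
      using mult_right_mono[OF cmod_cinner_le[of z x] norm_ge_zero[of x]]
      by (simp add: norm_scaleC mult_ac)
  qed (simp_all add: cinner_simps scaleC_add_left scaleR_scaleC scaleC_scaleC)
  then show ?thesis
    by (simp add: rank_one_def bounded_linear_Blinfun_apply)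
qed

lemma complex_linear_scaleC:
  "self_adjoint A \<Longrightarrow> blinfun_apply A (c *\<^sub>C x) = c *\<^sub>C blinfun_apply A x"
  by (simp add: self_adjoint_def complex_linear_def)

lemma self_adjoint_cinner:
  "self_adjoint A \<Longrightarrow> cinner (blinfun_apply A x) y = cinner x (blinfun_apply A y)"
  by (simp add: self_adjoint_def)

lemma self_adjoint_intros:
  "self_adjoint (rank_one x)" "self_adjoint 0" "self_adjoint id_blinfun"
  "self_adjoint A \<Longrightarrow> self_adjoint B \<Longrightarrow> self_adjoint (A + B)"
  "self_adjoint A \<Longrightarrow> self_adjoint B \<Longrightarrow> self_adjoint (A - B)"
  "self_adjoint A \<Longrightarrow> self_adjoint (r *\<^sub>R A)"
proof -
  show "self_adjoint (rank_one x)"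
    by (simp add: self_adjoint_def complex_linear_def cinner_simps scaleC_scaleC)
      (metis cinner_commute mult.commute)
qed (auto simp: self_adjoint_def complex_linear_def blinfun.bilinear_simps cinner_simps
    scaleC_add_right complex_vs.scale_right_diff_distrib scaleR_scaleC scaleC_scaleC mult.commute
    blinfun.zero_left)

text \<open>
  The quadratic form of \<open>A\<close>, made real-valued for every operator so that inequalities
  between forms make sense without self-adjointness.
\<close>

definition qf :: "('a::complex_hilbert \<Rightarrow>\<^sub>L 'a) \<Rightarrow> 'a \<Rightarrow> real" where
  "qf A x = Re (cinner (blinfun_apply A x) x)"

lemma op_le_qf: "A \<preceq> B \<longleftrightarrow> (\<forall>x. qf A x \<le> qf B x)"
  by (simp add: op_le_def qf_def)

lemma cinner_self_adjoint_self:
  assumes "self_adjoint A"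
  shows "cinner (blinfun_apply A x) x = of_real (qf A x)" "cinner x (blinfun_apply A x) = of_real (qf A x)"
proof -
  show "cinner (blinfun_apply A x) x = of_real (qf A x)"
    using self_adjoint_form_real[OF assms, of x] by (simp add: qf_def complex_eq_iff)
  then show "cinner x (blinfun_apply A x) = of_real (qf A x)"
    using assms by (simp add: self_adjoint_def)
qed

lemma qf_rank_one: "qf (rank_one x) z = (cmod (cinner z x))\<^sup>2"
proof -
  have "cinner (cinner z x *\<^sub>C x) z = of_real ((cmod (cinner z x))\<^sup>2)"
    using complex_norm_square[of "cinner z x"] cinner_commute[of x z]
    by (simp add: cinner_simps)
  then show ?thesis by (simp add: qf_def del: of_real_power)
qed

lemma qf_simps:
  "qf (A + B) z = qf A z + qf B z" "qf (A - B) z = qf A z - qf B z"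
  "qf (r *\<^sub>R A) z = r * qf A z" "qf 0 z = 0" "qf id_blinfun z = (norm z)\<^sup>2"
  by (simp_all add: qf_def blinfun.bilinear_simps cinner_simps blinfun.zero_left cinner_self
      del: of_real_power)

lemma op_le_refl [simp]: "A \<preceq> A" by (simp add: op_le_qf)

lemma op_le_trans: "A \<preceq> B \<Longrightarrow> B \<preceq> C \<Longrightarrow> A \<preceq> C"
  unfolding op_le_qf using order_trans by blast

lemma self_adjoint_eq_0:
  assumes A: "self_adjoint A" and "\<And>x. qf A x = 0"
  shows "A = 0"
proof (rule blinfun_eqI)
  fix x
  let ?y = "blinfun_apply A x"
  \<comment> \<open>at \<open>x + A x\<close> the cross terms are \<open>2 \<parallel>A x\<parallel>\<^sup>2\<close>\<close>
  have "0 = qf A (x + ?y)" by (simp add: assms)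
  also have "\<dots> = qf A x + qf A ?y + (Re (cinner ?y ?y) + Re (cinner (blinfun_apply A ?y) x))"
    by (simp add: qf_def blinfun.bilinear_simps cinner_simps)
  also have "cinner (blinfun_apply A ?y) x = cinner ?y ?y"
    by (simp add: self_adjoint_cinner[OF A])
  finally have "Re (cinner ?y ?y) = 0" by (simp add: assms)
  then show "?y = blinfun_apply 0 x"
    by (simp add: cinner_self blinfun.zero_left del: of_real_power)
qed

lemma op_le_antisym:
  assumes "self_adjoint A" "self_adjoint B" "A \<preceq> B" "B \<preceq> A"
  shows "A = B"
proof -
  have "A - B = 0"
    using assms by (intro self_adjoint_eq_0 self_adjoint_intros)
      (auto simp: op_le_qf qf_simps intro: antisym)
  then show ?thesis by simp
qed

lemma effectsI: "self_adjoint A \<Longrightarrow> 0 \<preceq> A \<Longrightarrow> A \<preceq> id_blinfun \<Longrightarrow> A \<in> effects"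
  by (simp add: effects_def)

lemma effectsD:
  assumes "A \<in> effects"
  shows "self_adjoint A" "0 \<preceq> A" "A \<preceq> id_blinfun" "0 \<le> qf A x" "qf A x \<le> (norm x)\<^sup>2"
proof -
  show *: "self_adjoint A" "0 \<preceq> A" "A \<preceq> id_blinfun"
    using assms by (auto simp: effects_def)
  show "0 \<le> qf A x" "qf A x \<le> (norm x)\<^sup>2"
    using *(2,3) unfolding op_le_qf qf_simps by blast+
qed

text \<open>
  The Cauchy-Schwarz inequality for the semidefinite form \<open>\<langle>Ax, y\<rangle>\<close>: after a rotation of \<open>x\<close> by a
  phase that makes \<open>\<langle>Ax, y\<rangle>\<close> nonnegative, it is the nonpositivity of the discriminant of the
  quadratic polynomial \<open>t \<mapsto> \<langle>A(x + ty), x + ty\<rangle>\<close>.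
\<close>

lemma positive_cauchy_schwarz:
  assumes A: "self_adjoint A" and pos: "0 \<preceq> A"
  shows "(cmod (cinner (blinfun_apply A x) y))\<^sup>2 \<le> qf A x * qf A y"
proof -
  have nonneg: "0 \<le> qf A z" for z
    using pos unfolding op_le_qf qf_simps by blast
  obtain c where c: "cmod c = 1"
    "c * cinner (blinfun_apply A x) y = of_real (cmod (cinner (blinfun_apply A x) y))"
    using ex_phase by blast
  define w where "w = c *\<^sub>C x"
  define b where "b = cmod (cinner (blinfun_apply A x) y)"
  have b: "cinner (blinfun_apply A w) y = of_real b"
    by (simp add: w_def b_def complex_linear_scaleC[OF A] cinner_simps c)
  have "cinner (blinfun_apply A y) w = cnj (cinner (blinfun_apply A w) y)"
    by (metis self_adjoint_cinner[OF A] cinner_commute)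
  then have b': "cinner (blinfun_apply A y) w = of_real b"
    by (simp add: b)
  have "c * cnj c = 1"
    using c(1) by (metis complex_norm_square of_real_1 power_one)
  moreover have "cinner (blinfun_apply A w) w = (c * cnj c) * cinner (blinfun_apply A x) x"
    by (simp add: w_def complex_linear_scaleC[OF A] cinner_simps)
  ultimately have qw: "qf A w = qf A x"
    by (simp add: qf_def)
  have expand: "qf A (w + t *\<^sub>R y) = qf A w + 2 * t * b + t\<^sup>2 * qf A y" for t
    by (simp add: qf_def blinfun.bilinear_simps cinner_simps b b' power2_eq_square algebra_simps)
  have "b\<^sup>2 \<le> qf A w * qf A y"
  proof (cases "qf A y = 0")
    case True
    have "b = 0"
    proof (rule ccontr)
      assume "b \<noteq> 0"
      define t where "t = - (qf A w + 1) / (2 * b)"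
      have "2 * t * b = - (qf A w + 1)"
        using \<open>b \<noteq> 0\<close> by (simp add: t_def)
      then have "qf A (w + t *\<^sub>R y) = - 1"
        by (simp add: expand True)
      then show False using nonneg by (metis not_one_le_zero neg_0_le_iff_le)
    qed
    then show ?thesis by (simp add: True)
  next
    case False
    then have pos: "qf A y > 0" using nonneg[of y] by simp
    have "0 \<le> qf A (w + (- b / qf A y) *\<^sub>R y)" by (rule nonneg)
    also have "\<dots> = qf A w - b\<^sup>2 / qf A y"
      by (subst expand) (use pos in \<open>simp add: power2_eq_square field_simps\<close>)
    finally show ?thesis
      using pos by (simp add: field_simps)
  qed
  then show ?thesis
    by (simp add: qw b_def)
qed

lemma positive_kernel:
  assumes "self_adjoint A" "0 \<preceq> A" "qf A x = 0"
  shows "blinfun_apply A x = 0"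
proof -
  have "(cmod (cinner (blinfun_apply A x) (blinfun_apply A x)))\<^sup>2 \<le> 0"
    using positive_cauchy_schwarz[OF assms(1,2), of x "blinfun_apply A x"] assms(3) by simp
  then show ?thesis by (simp add: cmod_cinner_self)
qed

text \<open>
  For invertible \<open>A\<close> this is the criterion \<open>s \<langle>A\<inverse>y, y\<rangle> \<le> 1\<close> for \<open>s \<cdot> rank_one y\<close> to be
  below \<open>A\<close>. Writing \<open>y = Aw\<close> avoids the inverse and covers all vectors in the range of \<open>A\<close>.
\<close>

lemma rank_one_le_positive_iff:
  assumes A: "self_adjoint A" "0 \<preceq> A" and s: "s \<ge> 0" and w: "blinfun_apply A w \<noteq> 0"
  shows "s *\<^sub>R rank_one (blinfun_apply A w) \<preceq> A \<longleftrightarrow> s * qf A w \<le> 1"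
proof
  assume *: "s *\<^sub>R rank_one (blinfun_apply A w) \<preceq> A"
  have "qf A w \<noteq> 0"
    using positive_kernel[OF A] w by blast
  moreover have "qf A w \<ge> 0"
    using A(2) unfolding op_le_qf qf_simps by blast
  ultimately have pos: "qf A w > 0" by simp
  have "s * (cmod (cinner w (blinfun_apply A w)))\<^sup>2 \<le> qf A w"
    using * unfolding op_le_qf qf_simps qf_rank_one by blast
  moreover have "cmod (cinner w (blinfun_apply A w)) = qf A w"
    using pos by (simp add: cinner_self_adjoint_self[OF A(1)])
  ultimately have "(s * qf A w) * qf A w \<le> 1 * qf A w"
    by (simp add: power2_eq_square mult.assoc)
  then show "s * qf A w \<le> 1"
    using pos mult_le_cancel_right_pos by blast
next
  assume s1: "s * qf A w \<le> 1"
  show "s *\<^sub>R rank_one (blinfun_apply A w) \<preceq> A"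
    unfolding op_le_qf qf_simps qf_rank_one
  proof
    fix z
    have qz: "qf A z \<ge> 0"
      using A(2) unfolding op_le_qf qf_simps by blast
    have "s * (cmod (cinner z (blinfun_apply A w)))\<^sup>2 \<le> s * (qf A w * qf A z)"
      using positive_cauchy_schwarz[OF A, of w z] s
      by (intro mult_left_mono) (simp_all add: cmod_cinner_commute[of z])
    also have "\<dots> = (s * qf A w) * qf A z" by simp
    also have "\<dots> \<le> 1 * qf A z"
      using s1 qz by (rule mult_right_mono)
    finally show "s * (cmod (cinner z (blinfun_apply A w)))\<^sup>2 \<le> qf A z" by simp
  qed
qed

lemma rank_one_scaleR: "rank_one (r *\<^sub>R x) = r\<^sup>2 *\<^sub>R rank_one x"
  by (rule blinfun_eqI)
    (simp add: blinfun.bilinear_simps cinner_simps scaleR_scaleC scaleC_scaleC power2_eq_square mult_ac)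

lemma rank_one_phase: "cmod c = 1 \<Longrightarrow> rank_one (c *\<^sub>C x) = rank_one x"
  by (rule blinfun_eqI)
    (simp add: cinner_simps scaleC_scaleC mult.commute[of "cnj c"] mult.assoc
      complex_norm_square[symmetric])

lemma rank_one_sqrt: "0 \<le> t \<Longrightarrow> rank_one (sqrt t *\<^sub>R x) = t *\<^sub>R rank_one x"
  by (simp add: rank_one_scaleR)

lemma rank_one_positive: "0 \<preceq> rank_one x"
  by (simp add: op_le_qf qf_simps qf_rank_one)

lemma rank_one_le_id_iff: "rank_one x \<preceq> id_blinfun \<longleftrightarrow> norm x \<le> 1"
proof (cases "x = 0")
  case True
  then show ?thesis by (simp add: op_le_qf qf_simps qf_rank_one)
next
  case False
  have "1 *\<^sub>R rank_one (blinfun_apply id_blinfun x) \<preceq> id_blinfun \<longleftrightarrow> 1 * qf id_blinfun x \<le> 1"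
    using False by (intro rank_one_le_positive_iff self_adjoint_intros)
      (simp_all add: op_le_qf qf_simps)
  then show ?thesis
    by (simp add: qf_simps power_le_one_iff)
qed

lemma rank_one_effect_iff: "rank_one x \<in> effects \<longleftrightarrow> norm x \<le> 1"
  by (auto simp: effects_def self_adjoint_intros rank_one_positive rank_one_le_id_iff)

text \<open>
  A positive operator below \<open>rank_one x\<close> annihilates the orthogonal complement of \<open>x\<close>; by
  self-adjointness its range is then contained in the line of \<open>x\<close>.
\<close>

lemma le_rank_one:
  assumes B: "self_adjoint B" "0 \<preceq> B" "B \<preceq> rank_one x"
  obtains t where "0 \<le> t" "t \<le> 1" "B = t *\<^sub>R rank_one x"
proof (cases "x = 0")
  case True
  then have "B = 0"
    using B by (intro op_le_antisym self_adjoint_intros) (auto simp: op_le_qf qf_simps qf_rank_one)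
  then show thesis by (intro that[of 0]) auto
next
  case x: False
  have bounds: "0 \<le> qf B z" "qf B z \<le> (cmod (cinner z x))\<^sup>2" for z
    using B unfolding op_le_qf qf_simps qf_rank_one by blast+
  have ker: "blinfun_apply B z = 0" if "cinner z x = 0" for z
    using bounds[of z] that by (intro positive_kernel B) simp
  define n where "n = (norm x)\<^sup>2"
  have n: "n > 0" using x by (simp add: n_def)
  define p where "p z = z - (cinner z x / of_real n) *\<^sub>C x" for z
  have p: "cinner (p z) x = 0" for z
    using n by (simp add: p_def cinner_simps cinner_self n_def del: of_real_power)
  have split: "z = (cinner z x / of_real n) *\<^sub>C x + p z" for z
    by (simp add: p_def)
  have Bz: "blinfun_apply B z = (cinner z x / of_real n) *\<^sub>C blinfun_apply B x" for z
    by (subst split) (simp add: blinfun.bilinear_simps complex_linear_scaleC[OF B(1)] ker p)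
  define q where "q = qf B x"
  have Bx: "blinfun_apply B x = (of_real q / of_real n) *\<^sub>C x"
  proof -
    have "cinner x (p z) = 0" for z
      using p[of z] cinner_commute[of x "p z"] by simp
    then have "cinner (p z) (p z) = cinner z (p z)" for z
      by (subst p_def) (simp add: cinner_simps)
    then have "cinner (p (blinfun_apply B x)) (p (blinfun_apply B x)) = cinner (blinfun_apply B x) (p (blinfun_apply B x))" .
    also have "\<dots> = 0"
      by (simp add: self_adjoint_cinner[OF B(1)] ker p)
    finally have "p (blinfun_apply B x) = 0" by (simp add: cinner_self)
    moreover have "cinner (blinfun_apply B x) x = of_real q"
      by (simp add: q_def cinner_self_adjoint_self[OF B(1)])
    ultimately show ?thesis
      using split[of "blinfun_apply B x"] by simp
  qed
  have "B = (q / n\<^sup>2) *\<^sub>R rank_one x"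
  proof (rule blinfun_eqI)
    show "blinfun_apply B z = blinfun_apply ((q / n\<^sup>2) *\<^sub>R rank_one x) z" for z
      by (subst Bz, subst Bx)
        (simp add: blinfun.bilinear_simps scaleR_scaleC scaleC_scaleC power2_eq_square mult_ac)
  qed
  moreover have "0 \<le> q" "q \<le> n\<^sup>2"
    using bounds[of x] by (simp_all add: q_def n_def cmod_cinner_self)
  ultimately show thesis
    using n by (intro that[of "q / n\<^sup>2"]) (auto simp: field_simps)
qed

lemma rank_one_le_rank_one:
  assumes "rank_one x \<preceq> rank_one y"
  obtains c where "cmod c \<le> 1" "x = c *\<^sub>C y"
proof -
  obtain t where t: "0 \<le> t" "t \<le> 1" "rank_one x = t *\<^sub>R rank_one y"
    using le_rank_one[OF self_adjoint_intros(1) rank_one_positive assms] by blast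
  have "cinner x x *\<^sub>C x = (of_real t * cinner x y) *\<^sub>C y"
    using arg_cong[OF t(3), of "\<lambda>A. blinfun_apply A x"]
    by (simp add: blinfun.bilinear_simps scaleR_scaleC scaleC_scaleC)
  then have "inverse (cinner x x) *\<^sub>C cinner x x *\<^sub>C x
      = (inverse (cinner x x) * (of_real t * cinner x y)) *\<^sub>C y"
    by (simp add: scaleC_scaleC)
  then have *: "\<exists>c. x = c *\<^sub>C y"
  proof (cases "x = 0")
    case True
    then show ?thesis by (intro exI[of _ 0]) simp
  next
    case False
    then have "inverse (cinner x x) * cinner x x = 1" by (simp add: cinner_self)
    then have "x = (inverse (cinner x x) * (of_real t * cinner x y)) *\<^sub>C y"
      using \<open>inverse (cinner x x) *\<^sub>C cinner x x *\<^sub>C x = _\<close>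
      by (simp only: scaleC_scaleC scaleC_one)
    then show ?thesis ..
  qed
  then obtain c where c: "x = c *\<^sub>C y" ..
  show thesis
  proof (cases "y = 0")
    case True
    then show thesis using c by (intro that[of 0]) auto
  next
    case False
    have "qf (rank_one x) y \<le> qf (rank_one y) y"
      using assms unfolding op_le_qf by blast
    then have "(cmod c)\<^sup>2 * ((norm y)\<^sup>2)\<^sup>2 \<le> 1 * ((norm y)\<^sup>2)\<^sup>2"
      by (simp add: qf_rank_one c cinner_simps norm_mult cmod_cinner_self power_mult_distrib del: mult_cancel_right1)
    then have "(cmod c)\<^sup>2 \<le> 1"
      using False by (subst (asm) mult_le_cancel_right_pos) auto
    then show thesis
      using c by (intro that[of c]) (auto simp: power_le_one_iff)
  qed
qed

text \<open>
  The minorant comes from \<open>rank_one_le_positive_iff\<close> with the largest admissible scalar. For this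
  choice it has the same expectation at \<open>y\<close> as \<open>A\<close>, which is what makes rank-one effects
  sufficient to test the order.
\<close>

lemma rank_one_minorant:
  assumes A: "A \<in> effects" and y: "blinfun_apply A y \<noteq> 0"
  obtains r where "r > 0" "r\<^sup>2 * qf A y = 1" "rank_one (r *\<^sub>R blinfun_apply A y) \<preceq> A"
    "norm (r *\<^sub>R blinfun_apply A y) \<le> 1"
proof -
  note A' = effectsD[OF A]
  have q: "qf A y > 0"
    using positive_kernel[OF A'(1,2), of y] y A'(4)[of y] by force
  define r where "r = sqrt (1 / qf A y)"
  have r: "r > 0" "r\<^sup>2 * qf A y = 1"
    using q by (simp_all add: r_def)
  have le: "rank_one (r *\<^sub>R blinfun_apply A y) \<preceq> A"
    using rank_one_le_positive_iff[OF A'(1,2) _ y, of "r\<^sup>2"] r(2) by (simp add: rank_one_scaleR)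
  then have "norm (r *\<^sub>R blinfun_apply A y) \<le> 1"
    using op_le_trans[OF le A'(3)] unfolding rank_one_le_id_iff by blast
  with r le show thesis by (rule that)
qed

lemma op_le_iff_rank_one_minorants:
  assumes A: "A \<in> effects" and B: "B \<in> effects"
  shows "A \<preceq> B \<longleftrightarrow> (\<forall>x. norm x \<le> 1 \<longrightarrow> rank_one x \<preceq> A \<longrightarrow> rank_one x \<preceq> B)"
proof
  assume *: "\<forall>x. norm x \<le> 1 \<longrightarrow> rank_one x \<preceq> A \<longrightarrow> rank_one x \<preceq> B"
  show "A \<preceq> B"
    unfolding op_le_qf
  proof
    fix y
    show "qf A y \<le> qf B y"
    proof (cases "blinfun_apply A y = 0")
      case True
      then show ?thesis using effectsD(4)[OF B, of y] by (simp add: qf_def[of A])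
    next
      case False
      obtain r where r: "r > 0" "r\<^sup>2 * qf A y = 1" "rank_one (r *\<^sub>R blinfun_apply A y) \<preceq> A"
        "norm (r *\<^sub>R blinfun_apply A y) \<le> 1"
        using rank_one_minorant[OF A False] by blast
      have "cmod (cinner y (blinfun_apply A y)) = qf A y"
        using effectsD(4)[OF A, of y] by (simp add: cinner_self_adjoint_self[OF effectsD(1)[OF A]])
      then have "qf (rank_one (r *\<^sub>R blinfun_apply A y)) y = r\<^sup>2 * qf A y * qf A y"
        unfolding rank_one_scaleR qf_simps qf_rank_one by (simp add: power2_eq_square)
      moreover have "qf (rank_one (r *\<^sub>R blinfun_apply A y)) y \<le> qf B y"
        using * r(3,4) unfolding op_le_qf by blast
      ultimately show ?thesis using r(2) by simp
    qed
  qed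
qed (use op_le_trans in blast)

text \<open>
  Below an effect whose range contains two independent vectors there are rank-one effects with
  different ranges, and these are incomparable. So if the order below \<open>A\<close> is total, the range of
  \<open>A\<close> is a line.
\<close>

lemma rank_one_iff_chain_below:
  assumes A: "A \<in> effects"
  shows "(\<exists>x. norm x \<le> 1 \<and> A = rank_one x) \<longleftrightarrow>
    (\<forall>B\<in>effects. \<forall>C\<in>effects. B \<preceq> A \<longrightarrow> C \<preceq> A \<longrightarrow> B \<preceq> C \<or> C \<preceq> B)"
proof
  assume "\<exists>x. norm x \<le> 1 \<and> A = rank_one x"
  then obtain x where x: "A = rank_one x" by blast
  show "\<forall>B\<in>effects. \<forall>C\<in>effects. B \<preceq> A \<longrightarrow> C \<preceq> A \<longrightarrow> B \<preceq> C \<or> C \<preceq> B"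
  proof (intro ballI impI)
    fix B C
    assume "B \<in> effects" "C \<in> effects" "B \<preceq> A" "C \<preceq> A"
    then obtain t u where B: "B = t *\<^sub>R rank_one x" and C: "C = u *\<^sub>R rank_one x"
      using le_rank_one[of B x] le_rank_one[of C x] effectsD(1,2) x by metis
    have "B \<preceq> C" if "t \<le> u" using that
      by (auto simp: op_le_qf B C qf_simps qf_rank_one intro: mult_right_mono)
    moreover have "C \<preceq> B" if "u \<le> t" using that
      by (auto simp: op_le_qf B C qf_simps qf_rank_one intro: mult_right_mono)
    ultimately show "B \<preceq> C \<or> C \<preceq> B" by linarith
  qed
next
  assume chain: "\<forall>B\<in>effects. \<forall>C\<in>effects. B \<preceq> A \<longrightarrow> C \<preceq> A \<longrightarrow> B \<preceq> C \<or> C \<preceq> B"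
  note A' = effectsD[OF A]
  show "\<exists>x. norm x \<le> 1 \<and> A = rank_one x"
  proof (cases "A = 0")
    case True
    then show ?thesis
      by (intro exI[of _ 0]) (auto intro!: blinfun_eqI simp: blinfun.zero_left)
  next
    case False
    then obtain y where y: "blinfun_apply A y \<noteq> 0"
      by (metis blinfun_eqI blinfun.zero_left)
    obtain r where r: "r > 0" "r\<^sup>2 * qf A y = 1" "rank_one (r *\<^sub>R blinfun_apply A y) \<preceq> A"
      "norm (r *\<^sub>R blinfun_apply A y) \<le> 1"
      using rank_one_minorant[OF A y] by blast
    define x where "x = r *\<^sub>R blinfun_apply A y"
    have range: "\<exists>c. blinfun_apply A w = c *\<^sub>C x" for w
    proof (cases "blinfun_apply A w = 0")
      case True
      then show ?thesis by (intro exI[of _ 0]) simp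
    next
      case False
      obtain q where q: "q > 0" "rank_one (q *\<^sub>R blinfun_apply A w) \<preceq> A"
        "norm (q *\<^sub>R blinfun_apply A w) \<le> 1"
        using rank_one_minorant[OF A False] by blast
      have scale: "blinfun_apply A w = of_real (inverse q) *\<^sub>C (q *\<^sub>R blinfun_apply A w)"
        using q(1) by (simp add: scaleR_scaleC scaleC_scaleC scaleC_one flip: of_real_mult)
      have "rank_one (q *\<^sub>R blinfun_apply A w) \<preceq> rank_one x \<or> rank_one x \<preceq> rank_one (q *\<^sub>R blinfun_apply A w)"
        using chain q r unfolding x_def by (auto simp: rank_one_effect_iff)
      then show ?thesis
      proof
        assume "rank_one (q *\<^sub>R blinfun_apply A w) \<preceq> rank_one x"
        then obtain c where "q *\<^sub>R blinfun_apply A w = c *\<^sub>C x"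
          using rank_one_le_rank_one by blast
        then show ?thesis
          using scale by (metis scaleC_scaleC)
      next
        assume "rank_one x \<preceq> rank_one (q *\<^sub>R blinfun_apply A w)"
        then obtain c where c: "x = c *\<^sub>C (q *\<^sub>R blinfun_apply A w)"
          using rank_one_le_rank_one by blast
        have "c \<noteq> 0"
          using c y r(1) by (auto simp: x_def)
        then have "q *\<^sub>R blinfun_apply A w = inverse c *\<^sub>C x"
          by (simp add: c scaleC_scaleC scaleC_one)
        then show ?thesis
          using scale by (metis scaleC_scaleC)
      qed
    qed
    have "blinfun_apply A w = blinfun_apply (rank_one x) w" for w
    proof -
      obtain c where c: "blinfun_apply A w = c *\<^sub>C x" using range by blast
      have "cinner w x = r * cinner (blinfun_apply A w) y"
        unfolding x_def by (simp add: cinner_simps self_adjoint_cinner[OF A'(1)])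
      also have "\<dots> = c * (r * cinner x y)"
        by (simp add: c cinner_simps)
      also have "r * cinner x y = r\<^sup>2 * cinner (blinfun_apply A y) y"
        by (simp add: x_def cinner_simps power2_eq_square)
      also have "cinner (blinfun_apply A y) y = of_real (qf A y)"
        by (rule cinner_self_adjoint_self[OF A'(1)])
      also have "of_real (r\<^sup>2) * complex_of_real (qf A y) = 1"
        using r(2) by (metis of_real_mult of_real_1)
      finally show ?thesis by (simp add: c)
    qed
    then have "A = rank_one x"
      by (rule blinfun_eqI)
    then show ?thesis
      using r(4) unfolding x_def by blast
  qed
qed

section \<open>Coexistence of effects\<close>

lemma rank_one_eq_iff:
  assumes "norm x = 1" "norm y = 1"
  shows "rank_one x = rank_one y \<longleftrightarrow> cmod (cinner x y) = 1"
proof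
  assume "rank_one x = rank_one y"
  then have "qf (rank_one x) y = qf (rank_one y) y" by simp
  then have "(cmod (cinner y x))\<^sup>2 = 1"
    by (simp add: qf_rank_one cmod_cinner_self assms)
  then show "cmod (cinner x y) = 1"
    unfolding cmod_cinner_commute[of y x] by (simp add: power2_eq_1_iff) (metis norm_ge_zero not_one_le_zero neg_0_le_iff_le)
next
  assume "cmod (cinner x y) = 1"
  then obtain c where "cmod c = 1" "x = c *\<^sub>C y"
    using parallel_if_cmod_cinner[of x y] assms by auto
  then show "rank_one x = rank_one y"
    by (simp add: rank_one_phase)
qed

lemma scaleR_effect:
  assumes A: "A \<in> effects" and t: "0 \<le> t" "t \<le> 1"
  shows "t *\<^sub>R A \<in> effects"
proof (rule effectsI)
  show "self_adjoint (t *\<^sub>R A)"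
    by (intro self_adjoint_intros effectsD[OF A])
  show "0 \<preceq> t *\<^sub>R A"
    using effectsD(4)[OF A] t by (simp add: op_le_qf qf_simps)
  show "t *\<^sub>R A \<preceq> id_blinfun"
    unfolding op_le_qf qf_simps
  proof
    fix x
    have "t * qf A x \<le> 1 * qf A x"
      using t effectsD(4)[OF A] by (intro mult_right_mono) auto
    then show "t * qf A x \<le> (norm x)\<^sup>2"
      using effectsD(5)[OF A, of x] by simp
  qed
qed

lemma id_effect: "id_blinfun \<in> effects"
  by (intro effectsI self_adjoint_intros) (auto simp: op_le_qf qf_simps)

lemma zero_effect: "0 \<in> effects"
  by (intro effectsI self_adjoint_intros) (auto simp: op_le_qf qf_simps)

lemma scaleR_rank_one_le_iff:
  assumes "norm x = 1" "0 \<le> s"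
  shows "s *\<^sub>R rank_one x \<preceq> r *\<^sub>R id_blinfun \<longleftrightarrow> s \<le> r"
proof
  assume "s *\<^sub>R rank_one x \<preceq> r *\<^sub>R id_blinfun"
  then have "qf (s *\<^sub>R rank_one x) x \<le> qf (r *\<^sub>R id_blinfun) x"
    unfolding op_le_qf by blast
  then show "s \<le> r"
    by (simp add: qf_simps qf_rank_one cmod_cinner_self assms)
next
  assume "s \<le> r"
  show "s *\<^sub>R rank_one x \<preceq> r *\<^sub>R id_blinfun"
    unfolding op_le_qf qf_simps qf_rank_one
  proof
    fix z
    have "(cmod (cinner z x))\<^sup>2 \<le> (norm z)\<^sup>2"
      using cmod_cinner_le[of z x] by (intro power_mono) (simp_all add: assms)
    then show "s * (cmod (cinner z x))\<^sup>2 \<le> r * (norm z)\<^sup>2"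
      using \<open>s \<le> r\<close> assms(2) by (intro mult_mono) auto
  qed
qed

text \<open>
  Both sides say that the expectation of \<open>I - A\<close> at \<open>x\<close> vanishes, which is the kernel condition
  for a positive operator.
\<close>

lemma rank_one_le_effect_iff:
  assumes x: "norm x = 1" and A: "A \<in> effects"
  shows "rank_one x \<preceq> A \<longleftrightarrow> blinfun_apply A x = x"
proof
  assume "rank_one x \<preceq> A"
  then have "qf (rank_one x) x \<le> qf A x"
    unfolding op_le_qf by blast
  then have "qf A x \<ge> 1"
    by (simp add: qf_rank_one cmod_cinner_self x)
  moreover have "qf A x \<le> 1"
    using effectsD(5)[OF A, of x] by (simp add: x)
  ultimately have "qf (id_blinfun - A) x = 0"
    by (simp add: qf_simps x)
  moreover have "0 \<preceq> id_blinfun - A"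
    using effectsD(3)[OF A] by (simp add: op_le_qf qf_simps)
  ultimately have "blinfun_apply (id_blinfun - A) x = 0"
    by (intro positive_kernel self_adjoint_intros effectsD[OF A])
  then show "blinfun_apply A x = x"
    by (simp add: blinfun.bilinear_simps)
next
  assume *: "blinfun_apply A x = x"
  then have "qf A x = 1"
    by (simp add: qf_def cinner_self x)
  moreover have "blinfun_apply A x \<noteq> 0"
    using * x by auto
  ultimately show "rank_one x \<preceq> A"
    using rank_one_le_positive_iff[OF effectsD(1,2)[OF A], of 1 x] * by simp
qed

lemma bessel2:
  fixes x y z :: "'a::complex_hilbert"
  assumes "norm x = 1" "norm y = 1" "cinner x y = 0"
  shows "(cmod (cinner z x))\<^sup>2 + (cmod (cinner z y))\<^sup>2 \<le> (norm z)\<^sup>2"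
proof -
  define p where "p = z - cinner z x *\<^sub>C x - cinner z y *\<^sub>C y"
  have "cinner y x = 0" using assms(3) cinner_commute[of y x] by simp
  then have px: "cinner p x = 0" "cinner p y = 0"
    using assms by (simp_all add: p_def cinner_simps cinner_self)
  have "(norm p)\<^sup>2 = Re (cinner p p)" by (simp add: cinner_self del: of_real_power)
  also have "cinner p p = cinner p z"
    by (subst (2) p_def) (simp add: cinner_simps px)
  also have "Re \<dots> = qf (id_blinfun - rank_one x - rank_one y) z"
    by (simp add: p_def qf_def blinfun.bilinear_simps cinner_simps)
  also have "\<dots> = (norm z)\<^sup>2 - (cmod (cinner z x))\<^sup>2 - (cmod (cinner z y))\<^sup>2"
    by (simp add: qf_simps qf_rank_one)
  finally show ?thesis
    using zero_le_power2[of "norm p"] by linarith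
qed

lemma rank_one_add_effect_iff:
  assumes "norm x = 1" "norm y = 1"
  shows "rank_one x + rank_one y \<in> effects \<longleftrightarrow> cinner x y = 0"
proof
  assume "rank_one x + rank_one y \<in> effects"
  from effectsD(5)[OF this, of x] show "cinner x y = 0"
    by (simp add: qf_simps qf_rank_one cmod_cinner_self assms)
next
  assume *: "cinner x y = 0"
  show "rank_one x + rank_one y \<in> effects"
    using bessel2[OF assms *]
    by (intro effectsI self_adjoint_intros) (auto simp: op_le_qf qf_simps qf_rank_one)
qed

text \<open>
  Scalars in \<open>(0, 1)\<close> are parametrized as \<open>1 / (1 + u)\<close> because the criterion then
  depends on the product of the parameters only. It is \<open>rank_one_le_positive_iff\<close> for the
  operator \<open>D = I - rank_one x / (1 + u)\<close> and \<open>y = Dw\<close>, where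
  \<open>w = y + (\<langle>y, x\<rangle> / u) x\<close> since \<open>D\<close> has the inverse \<open>I + rank_one x / u\<close>.
\<close>

lemma attenuated_rank_one_add_le_iff:
  assumes x: "norm x = 1" and y: "norm y = 1" and u: "0 < u" and v: "0 < v"
  shows "(1 / (1 + u)) *\<^sub>R rank_one x + (1 / (1 + v)) *\<^sub>R rank_one y \<preceq> id_blinfun \<longleftrightarrow>
    (cmod (cinner x y))\<^sup>2 \<le> u * v"
proof -
  define D where "D = id_blinfun - (1 / (1 + u)) *\<^sub>R rank_one x"
  define w where "w = y + (cinner y x / of_real u) *\<^sub>C x"
  have D: "self_adjoint D"
    unfolding D_def by (intro self_adjoint_intros)
  have "(1 / (1 + u)) *\<^sub>R rank_one x \<preceq> 1 *\<^sub>R id_blinfun"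
    using u by (subst scaleR_rank_one_le_iff) (auto simp: x)
  then have D0: "0 \<preceq> D"
    by (simp add: D_def op_le_qf qf_simps)
  have "of_real u \<noteq> (0::complex)" "1 + of_real u \<noteq> (0::complex)"
  proof -
    have "1 + of_real u = (of_real (1 + u) :: complex)" by simp
    then show "1 + of_real u \<noteq> (0::complex)"
      using u by (simp only: of_real_eq_0_iff)
  qed (use u in simp)
  then have coeff: "(cinner y x + cinner y x / of_real u) / (1 + of_real u) = cinner y x / of_real u"
    by (simp add: divide_simps) (simp add: algebra_simps)
  have "cinner w x = cinner y x + cinner y x / of_real u"
    by (simp add: w_def cinner_simps cinner_self x)
  then have "blinfun_apply D w = w - ((cinner y x + cinner y x / of_real u) / (1 + of_real u)) *\<^sub>C x"
    by (simp add: D_def blinfun.bilinear_simps scaleR_scaleC scaleC_scaleC)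
  then have Dw: "blinfun_apply D w = y"
    unfolding coeff by (simp add: w_def)
  have "y \<noteq> 0" using y by auto
  have "cinner y w = of_real (1 + (cmod (cinner x y))\<^sup>2 / u)"
    using complex_norm_square[of "cinner x y"] cinner_commute[of x y]
    by (simp add: w_def cinner_simps cinner_self y mult.commute)
  then have qw: "qf D w = 1 + (cmod (cinner x y))\<^sup>2 / u"
    by (simp only: qf_def Dw Re_complex_of_real)
  have "(1 / (1 + u)) *\<^sub>R rank_one x + (1 / (1 + v)) *\<^sub>R rank_one y \<preceq> id_blinfun \<longleftrightarrow>
    (1 / (1 + v)) *\<^sub>R rank_one (blinfun_apply D w) \<preceq> D"
    unfolding Dw by (auto simp: D_def op_le_qf qf_simps algebra_simps)
  also have "\<dots> \<longleftrightarrow> (1 / (1 + v)) * qf D w \<le> 1"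
    using v \<open>y \<noteq> 0\<close> by (intro rank_one_le_positive_iff D D0) (simp_all add: Dw)
  also have "\<dots> \<longleftrightarrow> (cmod (cinner x y))\<^sup>2 \<le> u * v"
    using u v by (simp add: divide_le_eq qw mult.commute)
  finally show ?thesis .
qed

text \<open>
  The common part \<open>G\<close> in the definition of coexistence is below both effects, hence a multiple of
  each. For effects with different ranges this leaves \<open>G = 0\<close>.
\<close>

lemma coexistent_rank_one_iff:
  assumes x: "norm x \<le> 1" and y: "norm y \<le> 1"
    and not_parallel: "cmod (cinner x y) < norm x * norm y"
  shows "coexistent (rank_one x) (rank_one y) \<longleftrightarrow> rank_one x + rank_one y \<in> effects"
proof
  assume "rank_one x + rank_one y \<in> effects"
  then show "coexistent (rank_one x) (rank_one y)"
    unfolding coexistent_def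
    by (intro bexI[of _ "rank_one x"] bexI[of _ "rank_one y"] bexI[of _ 0])
      (simp_all add: x y rank_one_effect_iff zero_effect)
next
  assume "coexistent (rank_one x) (rank_one y)"
  then obtain E F G where EFG: "E \<in> effects" "F \<in> effects" "G \<in> effects"
    "rank_one x = E + G" "rank_one y = F + G" "E + F + G \<in> effects"
    unfolding coexistent_def by blast
  have "G \<preceq> rank_one x" "G \<preceq> rank_one y"
    using effectsD(4)[OF EFG(1)] effectsD(4)[OF EFG(2)] EFG(4,5) by (simp_all add: op_le_qf qf_simps)
  then obtain t where t: "0 \<le> t" "G = t *\<^sub>R rank_one x" "G \<preceq> rank_one y"
    using le_rank_one[OF effectsD(1,2)[OF EFG(3)]] by metis
  have "t = 0"
  proof (rule ccontr)
    assume "t \<noteq> 0"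
    have "rank_one (sqrt t *\<^sub>R x) \<preceq> rank_one y"
      using t by (simp add: rank_one_sqrt)
    then obtain c where c: "sqrt t *\<^sub>R x = c *\<^sub>C y"
      using rank_one_le_rank_one by blast
    have "sqrt t * cmod (cinner x y) = cmod (cinner (sqrt t *\<^sub>R x) y)"
      using t(1) by (simp add: cinner_simps norm_mult)
    also have "\<dots> = norm (sqrt t *\<^sub>R x) * norm y"
      unfolding c by (simp add: cinner_simps norm_mult norm_scaleC cmod_cinner_self power2_eq_square)
    also have "\<dots> = sqrt t * (norm x * norm y)"
      using t(1) by simp
    finally show False
      using \<open>t \<noteq> 0\<close> not_parallel by simp
  qed
  then have "G = 0" using t(2) by simp
  then show "rank_one x + rank_one y \<in> effects"
    using EFG(6) unfolding EFG(4,5) by simp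
qed

text \<open>
  If \<open>A = E + G\<close> and \<open>rank_one x = F + G\<close> witness coexistence for a unit vector \<open>x\<close>, then \<open>E\<close>
  annihilates \<open>x\<close> because \<open>E + rank_one x \<le> I\<close>, and \<open>G\<close> is a multiple of \<open>rank_one x\<close>. So \<open>x\<close> is
  an eigenvector of \<open>A\<close>, and an operator for which every vector is an eigenvector is a scalar.
\<close>

lemma scalar_iff_coexistent_with_all:
  assumes A: "A \<in> effects"
  shows "(\<exists>t. 0 \<le> t \<and> t \<le> 1 \<and> A = t *\<^sub>R id_blinfun) \<longleftrightarrow> (\<forall>B\<in>effects. coexistent A B)"
proof
  assume "\<exists>t. 0 \<le> t \<and> t \<le> 1 \<and> A = t *\<^sub>R id_blinfun"
  then obtain t where t: "0 \<le> t" "t \<le> 1" "A = t *\<^sub>R id_blinfun" by blast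
  show "\<forall>B\<in>effects. coexistent A B"
  proof
    fix B :: "'a \<Rightarrow>\<^sub>L 'a" assume B: "B \<in> effects"
    have compl: "id_blinfun - B \<in> effects"
      using effectsD(4,5)[OF B]
      by (intro effectsI self_adjoint_intros effectsD[OF B]) (auto simp: op_le_qf qf_simps)
    \<comment> \<open>the joint observable of \<open>B\<close> and an independent coin with bias \<open>t\<close>\<close>
    let ?E = "t *\<^sub>R (id_blinfun - B)" and ?F = "(1 - t) *\<^sub>R B" and ?G = "t *\<^sub>R B"
    have "?E + ?F + ?G \<in> effects"
    proof (intro effectsI self_adjoint_intros effectsD[OF B])
      have eq: "qf (?E + ?F + ?G) x = t * (norm x)\<^sup>2 + (1 - t) * qf B x" for x
        by (simp add: qf_simps algebra_simps)
      show "0 \<preceq> ?E + ?F + ?G"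
        unfolding op_le_qf eq using t effectsD(4)[OF B] by (simp add: qf_simps)
      show "?E + ?F + ?G \<preceq> id_blinfun"
        unfolding op_le_qf eq
      proof
        fix x
        have "(1 - t) * qf B x \<le> (1 - t) * (norm x)\<^sup>2"
          using t effectsD(5)[OF B] by (intro mult_left_mono) auto
        moreover have "t * (norm x)\<^sup>2 + (1 - t) * (norm x)\<^sup>2 = (norm x)\<^sup>2"
          by (simp add: algebra_simps)
        ultimately show "t * (norm x)\<^sup>2 + (1 - t) * qf B x \<le> qf id_blinfun x"
          unfolding qf_simps by linarith
      qed
    qed
    moreover have "?E \<in> effects" "?F \<in> effects" "?G \<in> effects"
      using t B compl by (auto intro: scaleR_effect)
    moreover have "A = ?E + ?G" "B = ?F + ?G"
      by (simp_all add: t(3) algebra_simps)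
    ultimately show "coexistent A B"
      unfolding coexistent_def
      by (intro bexI[of _ ?E] bexI[of _ ?F] bexI[of _ ?G] conjI)
  qed
next
  assume coex: "\<forall>B\<in>effects. coexistent A B"
  have unit_eigen: "\<exists>c. blinfun_apply A x = c *\<^sub>C x" if x: "norm x = 1" for x
  proof -
    have "coexistent A (rank_one x)"
      using coex x by (simp add: rank_one_effect_iff)
    then obtain E F G where EFG: "E \<in> effects" "F \<in> effects" "G \<in> effects"
      "A = E + G" "rank_one x = F + G" "E + F + G \<in> effects"
      unfolding coexistent_def by blast
    have "qf (E + F + G) x \<le> 1"
      using effectsD(5)[OF EFG(6), of x] by (simp add: x)
    moreover have "qf (F + G) x = 1"
      unfolding EFG(5)[symmetric] by (simp add: qf_rank_one cmod_cinner_self x)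
    ultimately have "qf E x = 0"
      using effectsD(4)[OF EFG(1), of x] by (simp add: qf_simps x)
    then have "blinfun_apply E x = 0"
      by (intro positive_kernel effectsD[OF EFG(1)])
    moreover have "G \<preceq> rank_one x"
      unfolding EFG(5) using effectsD(4)[OF EFG(2)] by (simp add: op_le_qf qf_simps)
    then obtain t where "G = t *\<^sub>R rank_one x"
      by (rule le_rank_one[OF effectsD(1,2)[OF EFG(3)]])
    ultimately have "blinfun_apply A x = of_real t *\<^sub>C x"
      by (simp add: EFG(4) blinfun.bilinear_simps cinner_self x scaleR_scaleC scaleC_one)
    then show ?thesis ..
  qed
  have eigen: "\<exists>c. blinfun_apply A x = c *\<^sub>C x" for x
  proof (cases "x = 0")
    case False
    then obtain c where "blinfun_apply A (x /\<^sub>R norm x) = c *\<^sub>C (x /\<^sub>R norm x)"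
      using unit_eigen[of "x /\<^sub>R norm x"] by auto
    then have "norm x *\<^sub>R blinfun_apply A (x /\<^sub>R norm x) = norm x *\<^sub>R (c *\<^sub>C (x /\<^sub>R norm x))"
      by simp
    also have "\<dots> = c *\<^sub>C (norm x *\<^sub>R (x /\<^sub>R norm x))"
      by (simp only: scaleR_scaleC scaleC_scaleC mult_ac)
    finally show ?thesis
      using False by (auto simp: blinfun.bilinear_simps)
  qed (simp add: blinfun.zero_right)
  show "\<exists>t. 0 \<le> t \<and> t \<le> 1 \<and> A = t *\<^sub>R id_blinfun"
  proof (cases "\<exists>e::'a. norm e = 1")
    case False
    have "x = 0" for x :: 'a
    proof (rule ccontr)
      assume "x \<noteq> 0"
      then have "norm (x /\<^sub>R norm x) = 1" by simp
      with False show False by blast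
    qed
    then have "A = 0 *\<^sub>R id_blinfun" by (intro blinfun_eqI) metis
    then show ?thesis by (intro exI[of _ 0]) auto
  next
    case True
    then obtain e :: 'a where e: "norm e = 1" ..
    obtain a where a: "blinfun_apply A e = a *\<^sub>C e" using eigen by blast
    have aq: "a = of_real (qf A e)"
      using cinner_self_adjoint_self(1)[OF effectsD(1)[OF A], of e]
      by (simp add: a cinner_simps cinner_self e)
    have "blinfun_apply A y = a *\<^sub>C y" for y
    proof (cases "\<exists>c. y = c *\<^sub>C e")
      case True
      then show ?thesis
        by (auto simp: complex_linear_scaleC[OF effectsD(1)[OF A]] a scaleC_scaleC mult.commute)
    next
      case False
      obtain b where b: "blinfun_apply A y = b *\<^sub>C y" using eigen by blast
      obtain d where d: "blinfun_apply A (e + y) = d *\<^sub>C (e + y)" using eigen by blast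
      have "a *\<^sub>C e + b *\<^sub>C y = d *\<^sub>C e + d *\<^sub>C y"
        using d by (simp add: blinfun.bilinear_simps a b scaleC_add_right)
      then have eq: "(b - d) *\<^sub>C y = (d - a) *\<^sub>C e"
        by (simp add: complex_vs.scale_left_diff_distrib algebra_simps)
      have "b = d"
      proof (rule ccontr)
        assume "b \<noteq> d"
        then have "inverse (b - d) *\<^sub>C (b - d) *\<^sub>C y = y"
          by (simp add: scaleC_scaleC scaleC_one)
        then have "y = (inverse (b - d) * (d - a)) *\<^sub>C e"
          by (simp add: eq scaleC_scaleC)
        with False show False by blast
      qed
      moreover have "d = a"
        using eq \<open>b = d\<close> e by auto
      ultimately show ?thesis using b by simp
    qed
    then have "A = qf A e *\<^sub>R id_blinfun"
      by (intro blinfun_eqI) (simp add: blinfun.bilinear_simps aq scaleR_scaleC)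
    moreover have "0 \<le> qf A e" "qf A e \<le> 1"
      using effectsD(4,5)[OF A, of e] by (simp_all add: e)
    ultimately show ?thesis by blast
  qed
qed

section \<open>A functional equation on the positive reals\<close>

text \<open>
  Cauchy's functional equation: additivity gives \<open>F (k / n) = k F (1 / n)\<close>, the reflection law
  normalizes this to \<open>k / n\<close>, and monotonicity passes from rational to real arguments.
\<close>

lemma eq_id_on_unit_interval_if_additive:
  fixes F :: "real \<Rightarrow> real"
  assumes mono: "\<And>u v. 0 < u \<Longrightarrow> u < v \<Longrightarrow> v < 1 \<Longrightarrow> F u < F v"
    and add: "\<And>s t. 0 < s \<Longrightarrow> 0 < t \<Longrightarrow> s + t < 1 \<Longrightarrow> F (s + t) = F s + F t"
    and refl: "\<And>c. 0 < c \<Longrightarrow> c < 1 \<Longrightarrow> F c + F (1 - c) = 1"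
    and u: "0 < u" "u < 1"
  shows "F u = u"
proof -
  have mult: "F (real k / real n) = real k * F (1 / real n)" if "1 \<le> k" "k < n" for k n :: nat
    using that
  proof (induction k rule: nat_induct_at_least)
    case base
    then show ?case by simp
  next
    case (Suc k)
    have "F (real k / real n + 1 / real n) = F (real k / real n) + F (1 / real n)"
      using Suc.prems Suc.hyps by (intro add) (auto simp: field_simps)
    moreover have "real (Suc k) / real n = real k / real n + 1 / real n"
      by (simp add: add_divide_distrib)
    ultimately show ?case
      using Suc by (simp add: algebra_simps)
  qed
  have rat: "F (real k / real n) = real k / real n" if kn: "1 \<le> k" "k < n" for k n :: nat
  proof -
    have "1 - 1 / real n = real (n - 1) / real n"
      using kn by (simp add: field_simps of_nat_diff)
    then have "F (1 / real n) + F (real (n - 1) / real n) = 1"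
      using refl[of "1 / real n"] kn by simp
    then have "real n * F (1 / real n) = 1"
      using mult[of "n - 1" n] kn by (simp add: of_nat_diff algebra_simps)
    then show ?thesis
      using mult[OF kn] kn by (simp add: field_simps)
  qed
  have rat': "F q = q" if q: "q \<in> \<rat>" "0 < q" "q < 1" for q
  proof -
    obtain m n :: nat where "n \<noteq> 0" "\<bar>q\<bar> = real m / real n"
      by (rule Rats_abs_nat_div_natE[OF q(1)])
    then have mn: "q = real m / real n" using q by simp
    moreover have "1 \<le> m" "m < n"
      using q \<open>n \<noteq> 0\<close> unfolding mn by (auto simp: zero_less_divide_iff divide_less_eq)
    ultimately show ?thesis using rat by simp
  qed
  have F0: "F u > 0" and F1: "F u < 1"
  proof -
    obtain q where q: "q \<in> \<rat>" "0 < q" "q < u"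
      using Rats_dense_in_real[OF u(1)] by blast
    then show "F u > 0" using rat'[of q] mono[of q u] u by force
    obtain q where q: "q \<in> \<rat>" "u < q" "q < 1"
      using Rats_dense_in_real[OF u(2)] by blast
    then show "F u < 1" using rat'[of q] mono[of u q] u by force
  qed
  show ?thesis
  proof (rule linorder_cases[of "F u" u])
    assume "F u < u"
    then obtain q where q: "q \<in> \<rat>" "F u < q" "q < u"
      using Rats_dense_in_real by blast
    then have "F u < F u" using rat'[of q] mono[of q u] F0 u by force
    then show ?thesis by simp
  next
    assume "u < F u"
    then obtain q where q: "q \<in> \<rat>" "u < q" "q < F u"
      using Rats_dense_in_real by blast
    then have "F u < F u" using rat'[of q] mono[of u q] F1 u by force
    then show ?thesis by simp
  qed
qed

text \<open>
  For \<open>c < 1\<close> put \<open>C c = F 1 \<cdot> F c\<close> and \<open>a = (F 1)\<^sup>2\<close>. Applying \<open>C v \<cdot> C w = a \<cdot> C (v w)\<close> to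
  \<open>s = (s + t) p\<close> and \<open>t = (s + t) (1 - p)\<close> and using the reflection law \<open>C p + C (1 - p) = 1\<close> gives
  additivity up to the factor \<open>a\<close>. The values at \<open>1/4\<close>, \<open>1/2\<close> and \<open>3/4\<close> leave
  \<open>a = 1\<close> or \<open>a = 1/2\<close>, and the latter would give \<open>C (1/4) = C (1/2)\<close>. So \<open>F\<close> is additive on the
  unit interval, and the multiplicative law carries \<open>F u = u\<close> from there to all \<open>u\<close>.
\<close>

lemma eq_id_if_multiplicative_and_reflection:
  fixes F :: "real \<Rightarrow> real"
  assumes pos: "\<And>u. 0 < u \<Longrightarrow> 0 < F u"
    and mono: "\<And>u v. 0 < u \<Longrightarrow> u < v \<Longrightarrow> F u < F v"
    and mult: "\<And>u v. 0 < u \<Longrightarrow> 0 < v \<Longrightarrow> u * v < 1 \<Longrightarrow> F u * F v = F 1 * F (u * v)"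
    and refl: "\<And>c. 0 < c \<Longrightarrow> c < 1 \<Longrightarrow> F 1 * F c + F 1 * F (1 - c) = 1"
    and u: "0 < u"
  shows "F u = u"
proof -
  define C where "C w = F 1 * F w" for w
  define a where "a = F 1 * F 1"
  have C_mult: "C v * C w = a * C (v * w)" if "0 < v" "0 < w" "v * w < 1" for v w
    using mult[OF that] by (simp add: C_def a_def)
  have C_refl: "C c + C (1 - c) = 1" if "0 < c" "c < 1" for c
    using refl[OF that] by (simp add: C_def)
  have C_add: "C (s + t) = a * (C s + C t)" if st: "0 < s" "0 < t" "s + t < 1" for s t
  proof -
    define p where "p = s / (s + t)"
    have p: "0 < p" "p < 1" "(s + t) * p = s" "(s + t) * (1 - p) = t"
      using st by (auto simp: p_def field_simps)
    have "C (s + t) * C p = a * C s" "C (s + t) * C (1 - p) = a * C t"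
      using C_mult[of "s + t" p] C_mult[of "s + t" "1 - p"] p st by simp_all
    then have "C (s + t) * (C p + C (1 - p)) = a * (C s + C t)"
      by (simp add: algebra_simps)
    then show ?thesis using C_refl[OF p(1,2)] by simp
  qed
  have half: "C (1/2) = 1/2"
    using C_refl[of "1/2"] by simp
  have "a * C (1/4) = 1/4"
    using C_mult[of "1/2" "1/2"] half by simp
  moreover have "C (3/4) = a * (1/2 + C (1/4))" "C (1/4) + C (3/4) = 1"
    using C_add[of "1/2" "1/4"] C_refl[of "1/4"] half by simp_all
  ultimately have quarter: "C (1/4) = 3/4 - a/2"
    by (simp add: algebra_simps)
  with \<open>a * C (1/4) = 1/4\<close> have "(2 * a - 1) * (a - 1) = 0"
    by (simp add: algebra_simps)
  moreover have "C (1/4) < C (1/2)"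
    using mono[of "1/4" "1/2"] pos[of 1] by (simp add: C_def)
  ultimately have "a = 1"
    using quarter half by auto
  then have "(F 1)\<^sup>2 = 1" by (simp add: a_def power2_eq_square)
  then have F1: "F 1 = 1"
    using pos[of 1] by (simp add: power2_eq_1_iff)
  have F: "F w = w" if "0 < w" "w < 1" for w
  proof (rule eq_id_on_unit_interval_if_additive[OF _ _ _ that])
    show "F (s + t) = F s + F t" if "0 < s" "0 < t" "s + t < 1" for s t
      using C_add[OF that] by (simp add: C_def F1 \<open>a = 1\<close>)
    show "F c + F (1 - c) = 1" if "0 < c" "c < 1" for c
      using refl[OF that] by (simp add: F1)
  qed (use mono in auto)
  \<comment> \<open>small enough for both \<open>v\<close> and \<open>u v\<close> to lie in the unit interval\<close>
  define v where "v = 1 / (2 * u + 2)"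
  have v: "0 < v" "v < 1" "u * v < 1" "0 < u * v"
    using u by (auto simp: v_def field_simps)
  have "F u * v = u * v"
    using mult[OF u v(1,3)] F[OF v(1,2)] F[OF v(4,3)] F1 by simp
  then show ?thesis using v by simp
qed

section \<open>Automorphisms for order and coexistence\<close>

text \<open>
  The hypotheses are symmetric under passing to the inverse map, so whatever is shown for \<open>\<phi>\<close>
  is available for its inverse as well. The dimension enters as the existence of an orthonormal pair.
\<close>

locale coexistence_automorphism =
  fixes \<phi> :: "('a::complex_hilbert \<Rightarrow>\<^sub>L 'a) \<Rightarrow> ('a \<Rightarrow>\<^sub>L 'a)"
  assumes bij: "bij_betw \<phi> effects effects"
    and order: "A \<in> effects \<Longrightarrow> B \<in> effects \<Longrightarrow> A \<preceq> B \<longleftrightarrow> \<phi> A \<preceq> \<phi> B"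
    and coex: "A \<in> effects \<Longrightarrow> B \<in> effects \<Longrightarrow> coexistent A B \<longleftrightarrow> coexistent (\<phi> A) (\<phi> B)"
    and dim2: "\<exists>e f :: 'a. norm e = 1 \<and> norm f = 1 \<and> cinner e f = 0"
begin

lemma in_effects: "A \<in> effects \<Longrightarrow> \<phi> A \<in> effects"
  using bij by (auto simp: bij_betw_def)

lemma inj: "A \<in> effects \<Longrightarrow> B \<in> effects \<Longrightarrow> \<phi> A = \<phi> B \<longleftrightarrow> A = B"
  using bij by (auto simp: bij_betw_def inj_on_def)

lemma onto: "B \<in> effects \<Longrightarrow> \<exists>A\<in>effects. \<phi> A = B"
  using bij unfolding bij_betw_def by (metis imageE)

lemma inverse: "coexistence_automorphism (inv_into effects \<phi>)"
proof
  let ?\<psi> = "inv_into effects \<phi>"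
  show "bij_betw ?\<psi> effects effects"
    using bij by (rule bij_betw_inv_into)
  have \<psi>: "?\<psi> B \<in> effects" "\<phi> (?\<psi> B) = B" if "B \<in> effects" for B
    using bij that by (auto simp: bij_betw_def inv_into_into f_inv_into_f)
  show "A \<preceq> B \<longleftrightarrow> ?\<psi> A \<preceq> ?\<psi> B" "coexistent A B \<longleftrightarrow> coexistent (?\<psi> A) (?\<psi> B)"
    if "A \<in> effects" "B \<in> effects" for A B
    using order[of "?\<psi> A" "?\<psi> B"] coex[of "?\<psi> A" "?\<psi> B"] \<psi> that by simp_all
  show "\<exists>e f :: 'a. norm e = 1 \<and> norm f = 1 \<and> cinner e f = 0"
    by (rule dim2)
qed

lemma inverse_eq: "B \<in> effects \<Longrightarrow> inv_into effects \<phi> B = A \<Longrightarrow> A \<in> effects \<and> \<phi> A = B"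
  using bij by (auto simp: bij_betw_def inv_into_into f_inv_into_f)

lemma preserves_zero: "\<phi> 0 = 0"
proof -
  obtain A where A: "A \<in> effects" "\<phi> A = 0" using onto zero_effect by blast
  then have "\<phi> 0 \<preceq> 0"
    using order[OF zero_effect A(1)] effectsD(2) by metis
  then show ?thesis
    using effectsD(1,2) in_effects zero_effect by (intro op_le_antisym) blast+
qed

lemma preserves_id: "\<phi> id_blinfun = id_blinfun"
proof -
  obtain A where A: "A \<in> effects" "\<phi> A = id_blinfun" using onto id_effect by blast
  then have "id_blinfun \<preceq> \<phi> id_blinfun"
    using order[OF A(1) id_effect] effectsD(3) by metis
  then show ?thesis
    using effectsD(1,3) in_effects id_effect by (intro op_le_antisym) blast+
qed

lemma ex_rank_one:
  assumes x: "norm x \<le> 1"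
  shows "\<exists>y. norm y \<le> 1 \<and> \<phi> (rank_one x) = rank_one y"
proof -
  have Rx: "rank_one x \<in> effects"
    using x by (simp add: rank_one_effect_iff)
  have chain: "B \<preceq> C \<or> C \<preceq> B"
    if "B \<in> effects" "C \<in> effects" "B \<preceq> rank_one x" "C \<preceq> rank_one x" for B C
    using rank_one_iff_chain_below[OF Rx] x that by blast
  have "B \<preceq> C \<or> C \<preceq> B"
    if BC: "B \<in> effects" "C \<in> effects" and le: "B \<preceq> \<phi> (rank_one x)" "C \<preceq> \<phi> (rank_one x)" for B C
  proof -
    obtain B' C' where B': "B' \<in> effects" "\<phi> B' = B" and C': "C' \<in> effects" "\<phi> C' = C"
      using onto BC by metis
    have "B' \<preceq> rank_one x" "C' \<preceq> rank_one x"
      using le order B' C' Rx by blast+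
    then show ?thesis
      using chain[of B' C'] order B' C' by blast
  qed
  then show ?thesis
    using rank_one_iff_chain_below[OF in_effects[OF Rx]] by blast
qed

text \<open>
  The effects \<open>rank_one x\<close> with \<open>x\<close> a unit vector are maximal among those of rank one: if the image
  were not maximal, it would lie strictly below some \<open>rank_one u\<close>, whose preimage
  would lie strictly above \<open>rank_one x\<close>.
\<close>

lemma ex_unit:
  assumes x: "norm x = 1"
  shows "\<exists>y. norm y = 1 \<and> \<phi> (rank_one x) = rank_one y"
proof -
  interpret inv: coexistence_automorphism "inv_into effects \<phi>" by (rule inverse)
  obtain y where y: "norm y \<le> 1" "\<phi> (rank_one x) = rank_one y"
    using ex_rank_one x by force
  \<comment> \<open>a unit vector whose line contains \<open>y\<close>; if \<open>y = 0\<close>, any unit vector will do\<close>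
  define u where "u = (if y = 0 then x else y /\<^sub>R norm y)"
  have u: "norm u = 1" by (simp add: u_def x)
  have "y = norm y *\<^sub>R u" by (auto simp: u_def)
  then have "rank_one y = (norm y)\<^sup>2 *\<^sub>R rank_one u"
    by (metis rank_one_scaleR)
  moreover have "(norm y)\<^sup>2 * r \<le> r" if "r \<ge> 0" for r
    using that y(1) by (simp add: mult_left_le_one_le power_le_one)
  ultimately have y_le: "rank_one y \<preceq> rank_one u"
    by (simp add: op_le_qf qf_simps qf_rank_one)
  \<comment> \<open>the preimage of \<open>rank_one u\<close> is again of rank one, and it lies above \<open>rank_one x\<close>\<close>
  obtain z where "norm z \<le> 1" "inv_into effects \<phi> (rank_one u) = rank_one z"
    using inv.ex_rank_one[of u] u by auto
  then have z: "norm z \<le> 1" "rank_one z \<in> effects" "\<phi> (rank_one z) = rank_one u"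
    using inverse_eq[of "rank_one u"] u by (auto simp: rank_one_effect_iff)
  then have "rank_one x \<preceq> rank_one z"
    using order[of "rank_one x" "rank_one z"] y y_le x by (simp add: rank_one_effect_iff)
  then obtain c where c: "cmod c \<le> 1" "x = c *\<^sub>C z"
    using rank_one_le_rank_one by blast
  then have "1 = cmod c * norm z" using x by (simp add: norm_scaleC)
  moreover have "cmod c * norm z \<le> cmod c * 1"
    using z(1) by (intro mult_left_mono) auto
  ultimately have "cmod c = 1" using c(1) by linarith
  then have "rank_one x = rank_one z" by (simp add: c rank_one_phase)
  then show ?thesis using z u by auto
qed

definition \<sigma> :: "'a \<Rightarrow> 'a" where
  "\<sigma> x = (SOME y. norm y = 1 \<and> \<phi> (rank_one x) = rank_one y)"

lemma \<sigma>:
  assumes "norm x = 1"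
  shows norm_\<sigma>: "norm (\<sigma> x) = 1" and \<phi>_rank_one_unit: "\<phi> (rank_one x) = rank_one (\<sigma> x)"
  using someI_ex[OF ex_unit[OF assms]] by (simp_all add: \<sigma>_def)

lemma \<sigma>_onto:
  assumes y: "norm y = 1"
  shows "\<exists>x c. norm x = 1 \<and> y = c *\<^sub>C \<sigma> x"
proof -
  interpret inv: coexistence_automorphism "inv_into effects \<phi>" by (rule inverse)
  obtain x where x: "norm x = 1" "inv_into effects \<phi> (rank_one y) = rank_one x"
    using inv.ex_unit[OF y] by blast
  then have "\<phi> (rank_one x) = rank_one y"
    using inverse_eq[of "rank_one y"] y by (simp add: rank_one_effect_iff)
  then have "rank_one y = rank_one (\<sigma> x)"
    using \<phi>_rank_one_unit[OF x(1)] by simp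
  then have "cmod (cinner y (\<sigma> x)) = 1"
    using rank_one_eq_iff y norm_\<sigma>[OF x(1)] by blast
  then show ?thesis
    using parallel_if_cmod_cinner[of y "\<sigma> x"] y x(1) norm_\<sigma>[OF x(1)] by auto
qed

lemma scalar_effect: "0 < u \<Longrightarrow> (1 / (1 + u)) *\<^sub>R id_blinfun \<in> effects"
  by (intro scaleR_effect id_effect) auto

lemma scaleR_id_le_iff: "s *\<^sub>R id_blinfun \<preceq> t *\<^sub>R (id_blinfun :: 'a \<Rightarrow>\<^sub>L 'a) \<longleftrightarrow> s \<le> t"
proof
  obtain e :: 'a where "norm e = 1" using dim2 by blast
  moreover assume "s *\<^sub>R id_blinfun \<preceq> t *\<^sub>R (id_blinfun :: 'a \<Rightarrow>\<^sub>L 'a)"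
  then have "s * (norm e)\<^sup>2 \<le> t * (norm e)\<^sup>2"
    unfolding op_le_qf qf_simps by blast
  ultimately show "s \<le> t" by simp
qed (auto simp: op_le_qf qf_simps intro: mult_right_mono)

lemma ex_scalar:
  assumes u: "0 < u"
  shows "\<exists>v>0. \<phi> ((1 / (1 + u)) *\<^sub>R id_blinfun) = (1 / (1 + v)) *\<^sub>R id_blinfun"
proof -
  let ?S = "(1 / (1 + u)) *\<^sub>R (id_blinfun :: 'a \<Rightarrow>\<^sub>L 'a)"
  have S: "?S \<in> effects" using u by (rule scalar_effect)
  have "0 \<le> 1 / (1 + u)" "1 / (1 + u) \<le> 1" using u by auto
  then have "\<forall>B\<in>effects. coexistent ?S B"
    using scalar_iff_coexistent_with_all[OF S] by blast
  have "coexistent (\<phi> ?S) B" if B: "B \<in> effects" for B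
  proof -
    obtain B' where "B' \<in> effects" "\<phi> B' = B" using onto[OF B] by blast
    then show ?thesis
      using coex[OF S] \<open>\<forall>B\<in>effects. coexistent ?S B\<close> by blast
  qed
  then obtain t where t: "0 \<le> t" "t \<le> 1" "\<phi> ?S = t *\<^sub>R id_blinfun"
    using scalar_iff_coexistent_with_all[OF in_effects[OF S]] by blast
  have "t \<noteq> 0"
  proof
    assume "t = 0"
    then have "?S = 0"
      using t(3) inj[OF S zero_effect] by (simp add: preserves_zero)
    then have "?S \<preceq> 0 *\<^sub>R id_blinfun" by (simp only: scaleR_zero_left op_le_refl)
    then show False using u by (subst (asm) scaleR_id_le_iff) auto
  qed
  moreover have "t \<noteq> 1"
  proof
    assume "t = 1"
    then have "?S = id_blinfun"
      using t(3) inj[OF S id_effect] by (simp add: preserves_id)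
    then have "1 *\<^sub>R id_blinfun \<preceq> ?S" by (simp add: op_le_qf)
    then show False using u by (subst (asm) scaleR_id_le_iff) auto
  qed
  ultimately show ?thesis
    using t by (intro exI[of _ "1 / t - 1"]) auto
qed

definition F :: "real \<Rightarrow> real" where
  "F u = (SOME v. v > 0 \<and> \<phi> ((1 / (1 + u)) *\<^sub>R id_blinfun) = (1 / (1 + v)) *\<^sub>R id_blinfun)"

lemma F:
  assumes "0 < u"
  shows F_pos: "0 < F u"
    and \<phi>_scalar: "\<phi> ((1 / (1 + u)) *\<^sub>R id_blinfun) = (1 / (1 + F u)) *\<^sub>R id_blinfun"
  using someI_ex[OF ex_scalar[OF assms]] by (simp_all add: F_def)

lemma F_le_iff:
  assumes "0 < u" "0 < v"
  shows "F u \<le> F v \<longleftrightarrow> u \<le> v"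
proof -
  have "u \<le> v \<longleftrightarrow> 1 / (1 + v) \<le> 1 / (1 + u)"
    using assms by (simp add: field_simps)
  also have "\<dots> \<longleftrightarrow> 1 / (1 + F v) \<le> 1 / (1 + F u)"
    using order[OF scalar_effect[OF assms(2)] scalar_effect[OF assms(1)]]
    by (simp only: \<phi>_scalar assms scaleR_id_le_iff)
  also have "\<dots> \<longleftrightarrow> F u \<le> F v"
    using F_pos[OF assms(1)] F_pos[OF assms(2)] by (simp add: field_simps)
  finally show ?thesis by simp
qed

lemma F_onto:
  assumes w: "0 < w"
  shows "\<exists>u>0. F u = w"
proof -
  interpret inv: coexistence_automorphism "inv_into effects \<phi>" by (rule inverse)
  obtain u where u: "u > 0"
    "inv_into effects \<phi> ((1 / (1 + w)) *\<^sub>R id_blinfun) = (1 / (1 + u)) *\<^sub>R id_blinfun"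
    using inv.ex_scalar[OF w] by blast
  then have "\<phi> ((1 / (1 + u)) *\<^sub>R id_blinfun) = (1 / (1 + w)) *\<^sub>R id_blinfun"
    using inverse_eq[OF scalar_effect[OF w]] by blast
  then have "(1 / (1 + F u)) *\<^sub>R (id_blinfun :: 'a \<Rightarrow>\<^sub>L 'a) = (1 / (1 + w)) *\<^sub>R id_blinfun"
    using \<phi>_scalar[OF u(1)] by simp
  then have "1 / (1 + F u) = 1 / (1 + w)"
    by (metis scaleR_id_le_iff order_antisym order_refl)
  then show ?thesis
    using u(1) F_pos[OF u(1)] w by (intro exI[of _ u]) (simp add: field_simps)
qed

lemma attenuated_effect: "norm x = 1 \<Longrightarrow> 0 < u \<Longrightarrow> (1 / (1 + u)) *\<^sub>R rank_one x \<in> effects"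
  by (intro scaleR_effect) (auto simp: rank_one_effect_iff)

text \<open>
  The image is \<open>s \<cdot> rank_one (\<sigma> x)\<close> for some \<open>s\<close>, since it is below \<open>rank_one (\<sigma> x)\<close>. Its
  upper bounds among the scalars determine \<open>s\<close>, and these are images of scalars under \<open>F\<close>.
\<close>

lemma \<phi>_attenuated:
  assumes x: "norm x = 1" and u: "0 < u"
  shows "\<phi> ((1 / (1 + u)) *\<^sub>R rank_one x) = (1 / (1 + F u)) *\<^sub>R rank_one (\<sigma> x)"
proof -
  let ?A = "(1 / (1 + u)) *\<^sub>R rank_one x"
  have A: "?A \<in> effects" using x u by (rule attenuated_effect)
  have Rx: "rank_one x \<in> effects" using x by (simp add: rank_one_effect_iff)
  have "?A \<preceq> rank_one x"
    unfolding op_le_qf qf_simps qf_rank_one using u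
    by (intro allI mult_left_le_one_le) auto
  then have "\<phi> ?A \<preceq> rank_one (\<sigma> x)"
    using order[OF A Rx] by (simp add: \<phi>_rank_one_unit[OF x])
  then obtain s where s: "0 \<le> s" "s \<le> 1" "\<phi> ?A = s *\<^sub>R rank_one (\<sigma> x)"
    by (rule le_rank_one[OF effectsD(1,2)[OF in_effects[OF A]]])
  have le: "v \<le> u \<longleftrightarrow> s \<le> 1 / (1 + F v)" if v: "0 < v" for v
  proof -
    have "v \<le> u \<longleftrightarrow> 1 / (1 + u) \<le> 1 / (1 + v)"
      using u v by (simp add: field_simps)
    also have "\<dots> \<longleftrightarrow> ?A \<preceq> (1 / (1 + v)) *\<^sub>R id_blinfun"
      using u by (subst scaleR_rank_one_le_iff) (auto simp: x)
    also have "\<dots> \<longleftrightarrow> s *\<^sub>R rank_one (\<sigma> x) \<preceq> (1 / (1 + F v)) *\<^sub>R id_blinfun"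
      using order[OF A scalar_effect[OF v]] by (simp only: \<phi>_scalar[OF v] s(3))
    also have "\<dots> \<longleftrightarrow> s \<le> 1 / (1 + F v)"
      using s(1) norm_\<sigma>[OF x] by (subst scaleR_rank_one_le_iff) auto
    finally show ?thesis .
  qed
  have "s \<noteq> 0"
  proof
    assume "s = 0"
    then have "s \<le> 1 / (1 + F (u + 1))"
      using F_pos[of "u + 1"] u by simp
    then show False using le[of "u + 1"] u by simp
  qed
  define w where "w = 1 / s - 1"
  have sw: "s = 1 / (1 + w)" using \<open>s \<noteq> 0\<close> by (simp add: w_def)
  have "s \<le> 1 / (1 + F u)" using le[OF u] by simp
  then have Fu: "F u \<le> w"
    using \<open>s \<noteq> 0\<close> s(1) F_pos[OF u] by (simp add: w_def field_simps)
  then have "w > 0" using F_pos[OF u] by linarith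
  then obtain v where v: "0 < v" "F v = w" using F_onto by blast
  then have "v \<le> u" using le[OF v(1)] sw by simp
  then have "w \<le> F u" using F_le_iff[OF v(1) u] v by simp
  then show ?thesis using Fu sw s(3) by simp
qed

lemma cmod_cinner_\<sigma>_eq_1_iff:
  assumes x: "norm x = 1" and y: "norm y = 1"
  shows "cmod (cinner (\<sigma> x) (\<sigma> y)) = 1 \<longleftrightarrow> cmod (cinner x y) = 1"
proof -
  have "cmod (cinner (\<sigma> x) (\<sigma> y)) = 1 \<longleftrightarrow> \<phi> (rank_one x) = \<phi> (rank_one y)"
    using rank_one_eq_iff[of "\<sigma> x" "\<sigma> y"] x y by (simp add: \<sigma>)
  also have "\<dots> \<longleftrightarrow> rank_one x = rank_one y"
    by (intro inj) (simp_all add: rank_one_effect_iff x y)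
  also have "\<dots> \<longleftrightarrow> cmod (cinner x y) = 1"
    by (rule rank_one_eq_iff[OF x y])
  finally show ?thesis .
qed

lemma cmod_cinner_less_1:
  fixes x y :: 'a
  assumes "norm x = 1" "norm y = 1" "cmod (cinner x y) \<noteq> 1"
  shows "cmod (cinner x y) < 1"
  using cmod_cinner_le[of x y] assms by simp

text \<open>
  For unit vectors on different rays, orthogonality is the same as coexistence of the projections.
\<close>

lemma \<sigma>_orthogonal:
  assumes x: "norm x = 1" and y: "norm y = 1" and xy: "cinner x y = 0"
  shows "cinner (\<sigma> x) (\<sigma> y) = 0"
proof -
  have "coexistent (rank_one x) (rank_one y)"
    using coexistent_rank_one_iff[of x y] rank_one_add_effect_iff[OF x y] xy x y by simp
  then have "coexistent (rank_one (\<sigma> x)) (rank_one (\<sigma> y))"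
    using coex[of "rank_one x" "rank_one y"] by (simp add: rank_one_effect_iff \<sigma> x y)
  moreover have "cmod (cinner (\<sigma> x) (\<sigma> y)) < 1"
    using cmod_cinner_\<sigma>_eq_1_iff[OF x y] xy by (intro cmod_cinner_less_1) (simp_all add: \<sigma> x y)
  ultimately have "rank_one (\<sigma> x) + rank_one (\<sigma> y) \<in> effects"
    using coexistent_rank_one_iff[of "\<sigma> x" "\<sigma> y"] by (simp add: \<sigma> x y)
  then show ?thesis
    using rank_one_add_effect_iff[of "\<sigma> x" "\<sigma> y"] by (simp add: \<sigma> x y)
qed

lemma coexistent_attenuated_iff:
  fixes x y :: 'a
  assumes x: "norm x = 1" and y: "norm y = 1" and u: "0 < u" and v: "0 < v"
    and xy: "cmod (cinner x y) \<noteq> 1"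
  shows "coexistent ((1 / (1 + u)) *\<^sub>R rank_one x) ((1 / (1 + v)) *\<^sub>R rank_one y) \<longleftrightarrow>
    (cmod (cinner x y))\<^sup>2 \<le> u * v"
proof -
  let ?s = "sqrt (1 / (1 + u))" and ?t = "sqrt (1 / (1 + v))"
  have st: "0 < ?s" "?s \<le> 1" "0 < ?t" "?t \<le> 1" using u v by auto
  have eq: "(1 / (1 + u)) *\<^sub>R rank_one x = rank_one (?s *\<^sub>R x)"
    "(1 / (1 + v)) *\<^sub>R rank_one y = rank_one (?t *\<^sub>R y)"
    using u v by (simp_all add: rank_one_sqrt)
  have "(?s * ?t) * cmod (cinner x y) < (?s * ?t) * 1"
    using st cmod_cinner_less_1[OF x y xy] by (intro mult_strict_left_mono) auto
  then have "coexistent ((1 / (1 + u)) *\<^sub>R rank_one x) ((1 / (1 + v)) *\<^sub>R rank_one y) \<longleftrightarrow>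
    rank_one (?s *\<^sub>R x) + rank_one (?t *\<^sub>R y) \<in> effects"
    unfolding eq using st
    by (intro coexistent_rank_one_iff) (simp_all add: x y cinner_simps norm_mult)
  also have "\<dots> \<longleftrightarrow> rank_one (?s *\<^sub>R x) + rank_one (?t *\<^sub>R y) \<preceq> id_blinfun"
    by (auto simp: effects_def op_le_qf qf_simps qf_rank_one intro!: self_adjoint_intros)
  also have "\<dots> \<longleftrightarrow> (cmod (cinner x y))\<^sup>2 \<le> u * v"
    unfolding eq[symmetric] by (rule attenuated_rank_one_add_le_iff[OF x y u v])
  finally show ?thesis .
qed

lemma overlap_le_iff:
  assumes x: "norm x = 1" and y: "norm y = 1" and u: "0 < u" and v: "0 < v"
    and xy: "cmod (cinner x y) \<noteq> 1"
  shows "(cmod (cinner (\<sigma> x) (\<sigma> y)))\<^sup>2 \<le> F u * F v \<longleftrightarrow> (cmod (cinner x y))\<^sup>2 \<le> u * v"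
proof -
  have "cmod (cinner (\<sigma> x) (\<sigma> y)) \<noteq> 1"
    using xy cmod_cinner_\<sigma>_eq_1_iff[OF x y] by simp
  then have "(cmod (cinner (\<sigma> x) (\<sigma> y)))\<^sup>2 \<le> F u * F v \<longleftrightarrow>
      coexistent (\<phi> ((1 / (1 + u)) *\<^sub>R rank_one x)) (\<phi> ((1 / (1 + v)) *\<^sub>R rank_one y))"
    using coexistent_attenuated_iff[of "\<sigma> x" "\<sigma> y" "F u" "F v"]
    by (simp only: \<sigma> x y F_pos u v \<phi>_attenuated simp_thms)
  also have "\<dots> \<longleftrightarrow> coexistent ((1 / (1 + u)) *\<^sub>R rank_one x) ((1 / (1 + v)) *\<^sub>R rank_one y)"
    using coex[OF attenuated_effect[OF x u] attenuated_effect[OF y v]] by simp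
  also have "\<dots> \<longleftrightarrow> (cmod (cinner x y))\<^sup>2 \<le> u * v"
    by (rule coexistent_attenuated_iff[OF x y u v xy])
  finally show ?thesis .
qed

text \<open>
  By \<open>overlap_le_iff\<close>, the new transition probability is at most \<open>F u \<cdot> F v'\<close> exactly if
  \<open>v' \<ge> v\<close>. As \<open>F\<close> is onto, \<open>F u \<cdot> F v'\<close> takes all positive values below \<open>F u \<cdot> F v\<close> as well, so the
  bound is attained at \<open>v' = v\<close>.
\<close>

lemma overlap_eq:
  assumes x: "norm x = 1" and y: "norm y = 1" and u: "0 < u" and v: "0 < v"
    and uv: "(cmod (cinner x y))\<^sup>2 = u * v" "u * v < 1"
  shows "(cmod (cinner (\<sigma> x) (\<sigma> y)))\<^sup>2 = F u * F v"
proof (rule antisym)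
  let ?c = "(cmod (cinner (\<sigma> x) (\<sigma> y)))\<^sup>2"
  have xy: "cmod (cinner x y) \<noteq> 1" using uv by auto
  show le: "?c \<le> F u * F v"
    using overlap_le_iff[OF x y u v xy] uv by simp
  show "F u * F v \<le> ?c"
  proof (rule ccontr)
    assume *: "\<not> F u * F v \<le> ?c"
    \<comment> \<open>strictly between the bound and the alleged value, and positive even if \<open>?c = 0\<close>\<close>
    define z where "z = (?c / F u + F v) / 2"
    have "?c / F u < F v" using * F_pos[OF u] by (simp add: field_simps)
    then have z: "z < F v" "?c / F u \<le> z" by (simp_all add: z_def field_simps)
    have "0 < z" using F_pos[OF u] F_pos[OF v] by (auto simp: z_def intro: add_nonneg_pos)
    then obtain v' where v': "0 < v'" "F v' = z" using F_onto by blast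
    have "?c \<le> F u * F v'" using z(2) F_pos[OF u] v' by (simp add: field_simps)
    then have "u * v \<le> u * v'" using overlap_le_iff[OF x y u v'(1) xy] uv by simp
    then have "v \<le> v'" using u by simp
    then show False using F_le_iff[OF v v'(1)] v' z by simp
  qed
qed

text \<open>
  If \<open>y\<close> lies in the plane of \<open>x\<close> and \<open>w\<close>, then every effect above \<open>rank_one x\<close> and \<open>rank_one w\<close>
  fixes \<open>y\<close>, so it is above \<open>rank_one y\<close>. This is a statement about the order, hence
  \<open>rank_one (\<sigma> y) \<le> rank_one (\<sigma> x) + rank_one (\<sigma> w)\<close>. Evaluating at \<open>\<sigma> y\<close> gives one
  inequality and Bessel's inequality the other.
\<close>

lemma overlap_complement:
  assumes x: "norm x = 1" and w: "norm w = 1" and xw: "cinner x w = 0"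
    and y: "norm y = 1" "y = a *\<^sub>C x + b *\<^sub>C w"
  shows "(cmod (cinner (\<sigma> x) (\<sigma> y)))\<^sup>2 + (cmod (cinner (\<sigma> w) (\<sigma> y)))\<^sup>2 = 1"
proof (rule antisym)
  note unit = norm_\<sigma>[OF x] norm_\<sigma>[OF w] norm_\<sigma>[OF y(1)]
  have orth: "cinner (\<sigma> x) (\<sigma> w) = 0" using x w xw by (rule \<sigma>_orthogonal)
  show "(cmod (cinner (\<sigma> x) (\<sigma> y)))\<^sup>2 + (cmod (cinner (\<sigma> w) (\<sigma> y)))\<^sup>2 \<le> 1"
    using bessel2[OF unit(1,2) orth, of "\<sigma> y"]
    by (simp add: unit cmod_cinner_commute[of "\<sigma> y" "\<sigma> x"] cmod_cinner_commute[of "\<sigma> y" "\<sigma> w"])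
  let ?B = "rank_one (\<sigma> x) + rank_one (\<sigma> w)"
  have B: "?B \<in> effects"
    using rank_one_add_effect_iff[OF unit(1,2)] orth by blast
  \<comment> \<open>pull the sum back, so that it becomes an effect above \<open>rank_one x\<close> and \<open>rank_one w\<close>\<close>
  obtain A where A: "A \<in> effects" "\<phi> A = ?B" using onto[OF B] by blast
  have R: "rank_one x \<in> effects" "rank_one w \<in> effects" "rank_one y \<in> effects"
    by (simp_all add: rank_one_effect_iff x w y(1))
  have "rank_one (\<sigma> x) \<preceq> ?B" "rank_one (\<sigma> w) \<preceq> ?B"
    by (simp_all add: op_le_qf qf_simps qf_rank_one)
  then have "rank_one x \<preceq> A" "rank_one w \<preceq> A"
    using order[OF R(1) A(1)] order[OF R(2) A(1)] by (simp_all add: A(2) \<sigma> x w)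
  then have "blinfun_apply A x = x" "blinfun_apply A w = w"
    using rank_one_le_effect_iff A(1) x w by blast+
  then have "blinfun_apply A y = y"
    by (simp add: y(2) blinfun.bilinear_simps complex_linear_scaleC[OF effectsD(1)[OF A(1)]])
  then have "rank_one y \<preceq> A"
    using rank_one_le_effect_iff A(1) y(1) by blast
  then have "rank_one (\<sigma> y) \<preceq> ?B"
    using order[OF R(3) A(1)] by (simp add: A(2) \<sigma> y(1))
  then have "qf (rank_one (\<sigma> y)) (\<sigma> y) \<le> qf ?B (\<sigma> y)"
    unfolding op_le_qf by blast
  then show "1 \<le> (cmod (cinner (\<sigma> x) (\<sigma> y)))\<^sup>2 + (cmod (cinner (\<sigma> w) (\<sigma> y)))\<^sup>2"
    by (simp add: qf_simps qf_rank_one cmod_cinner_self unit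
        cmod_cinner_commute[of "\<sigma> y" "\<sigma> x"] cmod_cinner_commute[of "\<sigma> y" "\<sigma> w"])
qed

lemma ex_overlap:
  assumes c: "0 < c" "c < 1"
  obtains x w y :: 'a and a b where "norm x = 1" "norm w = 1" "norm y = 1" "cinner x w = 0"
    "y = a *\<^sub>C x + b *\<^sub>C w" "(cmod (cinner x y))\<^sup>2 = c" "(cmod (cinner w y))\<^sup>2 = 1 - c"
proof -
  obtain x w :: 'a where xw: "norm x = 1" "norm w = 1" "cinner x w = 0" using dim2 by blast
  then have wx: "cinner w x = 0" using cinner_commute[of w x] by simp
  define y where "y = of_real (sqrt c) *\<^sub>C x + of_real (sqrt (1 - c)) *\<^sub>C w"
  have "(norm y)\<^sup>2 = (norm (of_real (sqrt c) *\<^sub>C x))\<^sup>2 + (norm (of_real (sqrt (1 - c)) *\<^sub>C w))\<^sup>2"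
    unfolding y_def by (rule norm_add_orthogonal) (simp add: cinner_simps xw)
  also have "\<dots> = 1"
    using c by (simp add: norm_scaleC xw)
  finally have "norm y = 1" by (simp add: power2_eq_1_iff) (metis norm_ge_zero not_one_le_zero neg_0_le_iff_le)
  moreover have "cinner x y = of_real (sqrt c)" "cinner w y = of_real (sqrt (1 - c))"
    by (simp_all add: y_def cinner_simps cinner_self xw wx)
  then have "(cmod (cinner x y))\<^sup>2 = c" "(cmod (cinner w y))\<^sup>2 = 1 - c"
    using c by simp_all
  ultimately show thesis
    using xw y_def by (intro that[of x w y])
qed

text \<open>
  The value of \<open>F u \<cdot> F v\<close> is the transition probability that replaces \<open>u v\<close>, so it depends on
  \<open>u v\<close> only, and \<open>overlap_complement\<close> is the reflection law.
\<close>

lemma F_eq: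
  assumes "0 < u"
  shows "F u = u"
proof (rule eq_id_if_multiplicative_and_reflection[of F])
  show "F u < F v" if "0 < u" "u < v" for u v
    using F_le_iff[of v u] that by (simp add: not_le[symmetric])
  show "F u * F v = F 1 * F (u * v)" if uv: "0 < u" "0 < v" "u * v < 1" for u v
  proof -
    have pos: "0 < u * v" using uv by simp
    obtain x w y :: 'a and a b where "norm x = 1" "norm y = 1" "(cmod (cinner x y))\<^sup>2 = u * v"
      using ex_overlap[OF pos uv(3)] by metis
    then show ?thesis
      using overlap_eq[of x y u v] overlap_eq[of x y 1 "u * v"] uv pos by simp
  qed
  show "F 1 * F c + F 1 * F (1 - c) = 1" if c: "0 < c" "c < 1" for c
  proof -
    obtain x w y :: 'a and a b where xwy: "norm x = 1" "norm w = 1" "norm y = 1" "cinner x w = 0"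
      "y = a *\<^sub>C x + b *\<^sub>C w" "(cmod (cinner x y))\<^sup>2 = c" "(cmod (cinner w y))\<^sup>2 = 1 - c"
      using ex_overlap[OF c] by metis
    have "(cmod (cinner (\<sigma> x) (\<sigma> y)))\<^sup>2 = F 1 * F c"
      using overlap_eq[of x y 1 c] xwy c by simp
    moreover have "(cmod (cinner (\<sigma> w) (\<sigma> y)))\<^sup>2 = F 1 * F (1 - c)"
      using overlap_eq[of w y 1 "1 - c"] xwy c by simp
    ultimately show ?thesis
      using overlap_complement[OF xwy(1,2,4,3,5)] by simp
  qed
qed (use assms F_pos in auto)

lemma \<sigma>_transition:
  assumes x: "norm x = 1" and y: "norm y = 1"
  shows "cmod (cinner (\<sigma> x) (\<sigma> y)) = cmod (cinner x y)"
proof (cases "cmod (cinner x y) = 1")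
  case True
  then show ?thesis using cmod_cinner_\<sigma>_eq_1_iff[OF x y] by simp
next
  case False
  show ?thesis
  proof (cases "cinner x y = 0")
    case True
    then show ?thesis using \<sigma>_orthogonal[OF x y] by simp
  next
    case nz: False
    let ?c = "(cmod (cinner x y))\<^sup>2"
    have c: "0 < ?c" "?c < 1"
      using cmod_cinner_less_1[OF x y False] nz by (simp_all add: power_less_one_iff abs_square_less_1)
    then have "(cmod (cinner (\<sigma> x) (\<sigma> y)))\<^sup>2 = ?c"
      using overlap_eq[of x y 1 ?c] x y by (simp add: F_eq)
    then show ?thesis by simp
  qed
qed

text \<open>
  The map \<open>\<sigma>\<close> on unit vectors is extended to all vectors by positive homogeneity. That this
  extension also describes \<open>\<phi>\<close> on the multiples of projections is the fact that \<open>F\<close> is the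
  identity.
\<close>

lemma ex_wigner:
  obtains U where "unitary U \<or> antiunitary U"
    "\<And>x. norm x \<le> 1 \<Longrightarrow> \<phi> (rank_one x) = rank_one (U x)"
proof -
  define n where "n x = x /\<^sub>R norm x" for x :: 'a
  have n: "x = norm x *\<^sub>R n x" for x by (cases "x = 0") (simp_all add: n_def)
  have norm_n: "norm (n x) = 1" if "x \<noteq> 0" for x using that by (simp add: n_def)
  define s where "s x = norm x *\<^sub>R \<sigma> (n x)" for x
  have "cmod (cinner (s x) (s y)) = cmod (cinner x y)" for x y
  proof (cases "x = 0 \<or> y = 0")
    case False
    then have "cmod (cinner (s x) (s y)) = norm x * norm y * cmod (cinner (n x) (n y))"
      by (simp add: s_def cinner_simps norm_mult \<sigma>_transition norm_n)
    also have "\<dots> = cmod (cinner (norm x *\<^sub>R n x) (norm y *\<^sub>R n y))"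
      by (simp add: cinner_simps norm_mult)
    finally show ?thesis by (simp flip: n)
  qed (auto simp: s_def)
  moreover have "\<exists>c x. y = c *\<^sub>C s x" for y
  proof (cases "y = 0")
    case False
    obtain x c where x: "norm x = 1" "n y = c *\<^sub>C \<sigma> x"
      using \<sigma>_onto[OF norm_n[OF False]] by blast
    then have "y = (of_real (norm y) * c) *\<^sub>C s x"
      by (subst n) (simp add: s_def n_def scaleR_scaleC scaleC_scaleC)
    then show ?thesis by blast
  qed (auto intro: exI[of _ 0])
  ultimately obtain U where U: "unitary U \<or> antiunitary U"
    "\<And>x. \<exists>c. cmod c = 1 \<and> s x = c *\<^sub>C U x"
    using wigner[of s] by blast
  show thesis
  proof (rule that[OF U(1)])
    fix x :: 'a assume x: "norm x \<le> 1"
    have "rank_one (s x) = rank_one (U x)"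
      using U(2)[of x] rank_one_phase by metis
    moreover have "\<phi> (rank_one x) = rank_one (s x)"
    proof -
      consider "x = 0" | "norm x = 1" | "0 < norm x" "norm x < 1"
        using x by force
      then show ?thesis
      proof cases
        case 1
        have "rank_one (0::'a) = 0" by (rule blinfun_eqI) (simp add: blinfun.zero_left)
        then show ?thesis by (simp add: 1 s_def preserves_zero)
      next
        case 2
        then show ?thesis by (simp add: s_def n_def \<phi>_rank_one_unit)
      next
        case 3
        define u where "u = 1 / (norm x)\<^sup>2 - 1"
        have "(norm x)\<^sup>2 < 1" using 3 by (simp add: abs_square_less_1)
        then have u: "0 < u" "(norm x)\<^sup>2 = 1 / (1 + u)"
          using 3 by (simp_all add: u_def)
        have "rank_one x = (1 / (1 + u)) *\<^sub>R rank_one (n x)"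
          by (subst n) (simp only: rank_one_scaleR u(2))
        moreover have "rank_one (s x) = (1 / (1 + u)) *\<^sub>R rank_one (\<sigma> (n x))"
          by (simp only: s_def rank_one_scaleR u(2))
        ultimately show ?thesis
          using 3 u(1) by (simp add: \<phi>_attenuated norm_n F_eq)
      qed
    qed
    ultimately show "\<phi> (rank_one x) = rank_one (U x)" by simp
  qed
qed

end

section \<open>Implementation by a unitary or antiunitary operator\<close>

text \<open>
  An antiunitary \<open>U\<close> is still an isometric real-linear map, and the two conjugations in
  \<open>U \<circ> A \<circ> U\<^sup>*\<close> cancel. So the conjugate is complex linear and has the real expectations of \<open>A\<close>
  in both cases.
\<close>

lemma isometry_conjugation:
  assumes U: "unitary U \<or> antiunitary U" and A: "A \<in> effects"
  obtains B where "B \<in> effects" "blinfun_apply B = U \<circ> blinfun_apply A \<circ> adjoint U"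
    "\<And>x. qf B (U x) = qf A x"
proof -
  obtain \<kappa> where \<kappa>: "\<kappa> = id \<or> \<kappa> = cnj" and surj: "surj U"
    and add: "\<And>x y. U (x + y) = U x + U y" and scale: "\<And>c x. U (c *\<^sub>C x) = \<kappa> c *\<^sub>C U x"
    and cinner: "\<And>x y. cinner (U x) (U y) = \<kappa> (cinner x y)"
  proof -
    from U consider "unitary U" | "antiunitary U" by blast
    then show thesis
    proof cases
      case 1
      then show thesis by (intro that[of id]) (auto simp: unitary_def)
    next
      case 2
      then show thesis by (intro that[of cnj]) (auto simp: antiunitary_def)
    qed
  qed
  note A' = effectsD[OF A]
  have \<kappa>_simps: "\<kappa> (\<kappa> c) = c" "Re (\<kappa> c) = Re c" "\<kappa> (of_real r) = of_real r" for c r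
    using \<kappa> by auto
  let ?V = "adjoint U"
  have "U x \<bullet> U y = x \<bullet> y" for x y
    by (simp add: inner_eq_Re_cinner cinner \<kappa>_simps)
  then have inv: "U (?V y) = y" "?V (U x) = x" for x y
    using adjoint_of_surj_isometry[OF surj] by blast+
  have V_add: "?V (x + y) = ?V x + ?V y" for x y
    using add[of "?V x" "?V y"] inv by metis
  have V_scale: "?V (c *\<^sub>C x) = \<kappa> c *\<^sub>C ?V x" for c x
    using scale[of "\<kappa> c" "?V x"] inv \<kappa>_simps by metis
  have norm_U: "norm (U x) = norm x" for x
    by (simp add: norm_eq_sqrt_inner inner_eq_Re_cinner cinner \<kappa>_simps)
  have norm_V: "norm (?V x) = norm x" for x
    using norm_U[of "?V x"] inv by simp
  define B where "B = Blinfun (U \<circ> blinfun_apply A \<circ> ?V)"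
  have "bounded_linear (U \<circ> blinfun_apply A \<circ> ?V)"
  proof (rule bounded_linear_intro)
    show "norm ((U \<circ> blinfun_apply A \<circ> ?V) x) \<le> norm x * norm A" for x
      using norm_blinfun[of A "?V x"] by (simp add: norm_U norm_V mult.commute)
  qed (simp_all add: add V_add blinfun.bilinear_simps scaleR_scaleC scale V_scale \<kappa>_simps
      complex_linear_scaleC[OF A'(1)])
  then have B: "blinfun_apply B = U \<circ> blinfun_apply A \<circ> ?V"
    by (simp add: B_def bounded_linear_Blinfun_apply)
  have adj: "cinner (blinfun_apply B x) y = cinner x (blinfun_apply B y)" for x y
  proof -
    have "cinner (blinfun_apply B x) (U (?V y)) = cinner (U (?V x)) (blinfun_apply B y)"
      by (simp add: B cinner self_adjoint_cinner[OF A'(1)])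
    then show ?thesis by (simp add: inv)
  qed
  have qB: "qf B (U x) = qf A x" for x
    by (simp add: qf_def B inv cinner \<kappa>_simps)
  have "B \<in> effects"
  proof (rule effectsI)
    show "self_adjoint B"
      using adj by (simp add: self_adjoint_def complex_linear_def B V_scale scale \<kappa>_simps
          complex_linear_scaleC[OF A'(1)])
    have "qf B y = qf A (?V y)" for y
      using qB[of "?V y"] inv by simp
    then show "0 \<preceq> B" "B \<preceq> id_blinfun"
      using A'(4) A'(5) norm_V by (auto simp: op_le_qf qf_simps) (metis norm_V A'(5))
  qed
  then show thesis using B qB by (rule that)
qed

theorem corollary5:
  fixes \<phi> :: "('a::complex_hilbert \<Rightarrow>\<^sub>L 'a) \<Rightarrow> ('a \<Rightarrow>\<^sub>L 'a)"
  assumes dim: "\<exists>S :: 'a set. complex_vs.independent S \<and> card S = 2"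
    and bij: "bij_betw \<phi> effects effects"
    and order: "\<And>A B. A \<in> effects \<Longrightarrow> B \<in> effects \<Longrightarrow> A \<preceq> B \<longleftrightarrow> \<phi> A \<preceq> \<phi> B"
    and coex: "\<And>A B. A \<in> effects \<Longrightarrow> B \<in> effects \<Longrightarrow>
      coexistent A B \<longleftrightarrow> coexistent (\<phi> A) (\<phi> B)"
  shows "\<exists>U :: 'a \<Rightarrow> 'a. (unitary U \<or> antiunitary U) \<and>
    (\<forall>A\<in>effects. blinfun_apply (\<phi> A) = U \<circ> blinfun_apply A \<circ> adjoint U)"
proof -
  interpret coexistence_automorphism \<phi>
    using dim ex_orthonormal_pair bij order coex by unfold_locales blast+
  obtain U where U: "unitary U \<or> antiunitary U"
    and \<phi>_rank_one: "\<And>x. norm x \<le> 1 \<Longrightarrow> \<phi> (rank_one x) = rank_one (U x)"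
    using ex_wigner by blast
  have surj: "surj U" and cmod_U: "cmod (cinner (U x) (U y)) = cmod (cinner x y)" for x y
    using U by (auto simp: unitary_def antiunitary_def)
  have norm_U: "norm (U x) = norm x" for x
    using cmod_U[of x x] by (simp add: cmod_cinner_self)
  have "blinfun_apply (\<phi> A) = U \<circ> blinfun_apply A \<circ> adjoint U" if A: "A \<in> effects" for A
  proof -
    obtain B where B: "B \<in> effects" "blinfun_apply B = U \<circ> blinfun_apply A \<circ> adjoint U"
      "\<And>x. qf B (U x) = qf A x"
      using isometry_conjugation[OF U A] by blast
    \<comment> \<open>both sides say that the effect of rank one at the preimage of \<open>y\<close> is below \<open>A\<close>\<close>
    have same: "rank_one y \<preceq> \<phi> A \<longleftrightarrow> rank_one y \<preceq> B" if y: "norm y \<le> 1" for y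
    proof -
      obtain x where x: "y = U x" using surj by (metis surjD)
      have nx: "norm x \<le> 1" using y by (simp add: x norm_U)
      have "rank_one y \<preceq> \<phi> A \<longleftrightarrow> rank_one x \<preceq> A"
        using order[OF _ A, of "rank_one x"] nx by (simp add: x \<phi>_rank_one rank_one_effect_iff)
      also have "\<dots> \<longleftrightarrow> (\<forall>z. qf (rank_one (U x)) (U z) \<le> qf B (U z))"
        by (simp add: op_le_qf qf_rank_one cmod_U B(3))
      also have "\<dots> \<longleftrightarrow> rank_one y \<preceq> B"
        unfolding op_le_qf x using surj by (metis surjD)
      finally show ?thesis .
    qed
    have "\<phi> A = B"
      using same op_le_iff_rank_one_minorants in_effects[OF A] B(1)
      by (intro op_le_antisym effectsD(1)) blast+
    then show ?thesis using B(2) by simp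
  qed
  then show ?thesis using U by blast
qed

end
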